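(* Let $N\in\mathbb{N}$ and $s\in(0,\min\{N/2,1\})$. There exists a radial potential $\mathscr{V}\in C^1(B_1\setminus\{0\})\cap C^0(B_1)$ satisfying $$|\mathscr{V}(x)|+|x\cdot\nabla\mathscr{V}(x)|\le C_{\mathscr{V}}|x|^{-2s+\varepsilon}\quad\text{as }|x|\to0,\ \text{for some } C_{\mathscr{V}}>0,\ \varepsilon>0,$$ with $\mathscr{V}>0$ in $B_1\setminus\{0\}$, such that there is a nontrivial radial weak solution $u\in\mathcal{D}^{s,2}_{\mathrm{rad}}(\mathbb{R}^N)$ of $$(-\Delta)^s u=\mathscr{V}u\quad\text{in }B_1$$ with $u(0)=0$. Moreover, $u\equiv0$ in $\mathbb{R}^N\setminus B_R$ for some $R\ge1$, and $u\not\equiv0$ in $\Omega$ for every non-empty open set $\Omega\subseteq B_R$. Finally: if $N\ge6s$ and $0<\alpha<4s/(N-2s)$, $\mathscr{V}$ can be taken in $C^{0,\alpha}_{\mathrm{loc}}(B_1)$; if $N<6s$, $\mathscr{V}$ can be taken in $C^1(B_1)$.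
   Context: $B_r=\{x\in\mathbb{R}^N:|x|<r\}$. $\mathcal{D}^{s,2}(\mathbb{R}^N)$ is the completion of $C_c^\infty(\mathbb{R}^N)$ with respect to the norm induced by the scalar product $(u,v)_{\mathcal{D}^{s,2}}=\frac{C_{N,s}}{2}\int_{\mathbb{R}^{2N}}\frac{(u(x)-u(y))(v(x)-v(y))}{|x-y|^{N+2s}}\,dx\,dy$, where $C_{N,s}=2^{2s}\pi^{-N/2}\Gamma(\frac{N+2s}{2})/|\Gamma(-s)|$; $\mathcal{D}^{s,2}_{\mathrm{rad}}(\mathbb{R}^N)$ is its subspace of radial functions. A radial weak solution is $u\in\mathcal{D}^{s,2}_{\mathrm{rad}}(\mathbb{R}^N)$ with $(u,\varphi)_{\mathcal{D}^{s,2}}=\int_{\mathbb{R}^N}\mathscr{V}u\varphi\,dx$ for all $\varphi\in C_c^\infty(B_1)$. *)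

theory Defs
  imports "HOL-Analysis.Analysis"
begin

fun Ck_fun :: "nat \<Rightarrow> ('a::euclidean_space \<Rightarrow> real) \<Rightarrow> bool" where
  "Ck_fun 0 f = continuous_on UNIV f"
| "Ck_fun (Suc k) f =
     (f differentiable_on UNIV \<and>
      (\<forall>i\<in>Basis. Ck_fun k (\<lambda>x. frechet_derivative f (at x) i)))"

definition smooth_fun :: "('a::euclidean_space \<Rightarrow> real) \<Rightarrow> bool" where
  "smooth_fun f \<longleftrightarrow> (\<forall>k. Ck_fun k f)"

definition tsupp :: "('a::euclidean_space \<Rightarrow> real) \<Rightarrow> 'a set" where
  "tsupp f = closure {x. f x \<noteq> 0}"

definition test_fun :: "'a::euclidean_space set \<Rightarrow> ('a \<Rightarrow> real) \<Rightarrow> bool" where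
  "test_fun U f \<longleftrightarrow> smooth_fun f \<and> compact (tsupp f) \<and> tsupp f \<subseteq> U"

definition C_Ns :: "nat \<Rightarrow> real \<Rightarrow> real" where
  "C_Ns n \<sigma> = (2::real) powr (2 * \<sigma>) * pi powr (- real n / 2) * Gamma ((real n + 2 * \<sigma>) / 2) / abs (Gamma (- \<sigma>))"

definition Ds_inner :: "real \<Rightarrow> ('a::euclidean_space \<Rightarrow> real) \<Rightarrow> ('a \<Rightarrow> real) \<Rightarrow> real" where
  "Ds_inner s u v = C_Ns DIM('a) s / 2 *
     (\<integral>p. (u (fst p) - u (snd p)) * (v (fst p) - v (snd p)) /
             norm (fst p - snd p) powr (real DIM('a) + 2 * s) \<partial>(lborel \<Otimes>\<^sub>M lborel))"

definition gagliardo_sq :: "real \<Rightarrow> ('a::euclidean_space \<Rightarrow> real) \<Rightarrow> ennreal" where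
  "gagliardo_sq s u = (\<integral>\<^sup>+p. ennreal ((u (fst p) - u (snd p))^2 /
             norm (fst p - snd p) powr (real DIM('a) + 2 * s)) \<partial>(lborel \<Otimes>\<^sub>M lborel))"

definition crit_exp :: "nat \<Rightarrow> real \<Rightarrow> real" where
  "crit_exp N s = 2 * real N / (real N - 2 * s)"

text \<open>Concrete realisation of the completion D^{s,2}(R^N) (for 0 < s < N/2):
  functions that are limits of C_c^infinity functions both in the Gagliardo seminorm and
  in L^{2^*_s} (the standard identification of the abstract completion with a function space).\<close>
definition Ds2 :: "real \<Rightarrow> ('a::euclidean_space \<Rightarrow> real) set" where
  "Ds2 s = {u. u \<in> borel_measurable lborel \<and>
     (\<exists>\<phi>::nat \<Rightarrow> 'a \<Rightarrow> real. (\<forall>k. test_fun UNIV (\<phi> k)) \<and>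
        ((\<lambda>k. gagliardo_sq s (\<lambda>x. \<phi> k x - u x)) \<longlongrightarrow> 0) sequentially \<and>
        ((\<lambda>k. \<integral>\<^sup>+x. ennreal (\<bar>\<phi> k x - u x\<bar> powr crit_exp DIM('a) s) \<partial>lborel) \<longlongrightarrow> 0) sequentially)}"

definition radial :: "('a::real_normed_vector \<Rightarrow> real) \<Rightarrow> bool" where
  "radial f \<longleftrightarrow> (\<forall>x y. norm x = norm y \<longrightarrow> f x = f y)"

definition Ds2_rad :: "real \<Rightarrow> ('a::euclidean_space \<Rightarrow> real) set" where
  "Ds2_rad s = {u \<in> Ds2 s. radial u}"

definition radial_weak_solution :: "real \<Rightarrow> ('a::euclidean_space \<Rightarrow> real) \<Rightarrow> ('a \<Rightarrow> real) \<Rightarrow> bool" where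
  "radial_weak_solution s V u \<longleftrightarrow> u \<in> Ds2_rad s \<and>
     (\<forall>\<phi>. test_fun (ball 0 1) \<phi> \<longrightarrow> Ds_inner s u \<phi> = (\<integral>x. V x * u x * \<phi> x \<partial>lborel))"

definition C1_on :: "'a::euclidean_space set \<Rightarrow> ('a \<Rightarrow> real) \<Rightarrow> bool" where
  "C1_on U f \<longleftrightarrow> (\<exists>g::'a \<Rightarrow> 'a. (\<forall>x\<in>U. (f has_derivative (\<lambda>h. g x \<bullet> h)) (at x)) \<and> continuous_on U g)"

definition holder_loc :: "real \<Rightarrow> 'a::euclidean_space set \<Rightarrow> ('a \<Rightarrow> real) \<Rightarrow> bool" where
  "holder_loc \<alpha> U f \<longleftrightarrow> continuous_on U f \<and>
     (\<forall>K. compact K \<and> K \<subseteq> U \<longrightarrow> (\<exists>C. \<forall>x\<in>K. \<forall>y\<in>K. \<bar>f x - f y\<bar> \<le> C * norm (x - y) powr \<alpha>))"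

definition thm12_props :: "real \<Rightarrow> ('a::euclidean_space \<Rightarrow> real) \<Rightarrow> ('a \<Rightarrow> real) \<Rightarrow> bool" where
  "thm12_props s V u \<longleftrightarrow>
     radial V \<and>
     continuous_on (ball 0 1) V \<and> C1_on (ball 0 1 - {0}) V \<and>
     (\<exists>g::'a \<Rightarrow> 'a. (\<forall>x\<in>ball 0 1 - {0}. (V has_derivative (\<lambda>h. g x \<bullet> h)) (at x)) \<and>
        (\<exists>CV>0. \<exists>\<epsilon>>0. eventually (\<lambda>x. \<bar>V x\<bar> + \<bar>x \<bullet> g x\<bar> \<le> CV * norm x powr (- 2 * s + \<epsilon>)) (at 0))) \<and>
     (\<forall>x\<in>ball 0 1 - {0}. V x > 0) \<and>
     radial_weak_solution s V u \<and>
     \<not> (AE x in lborel. u x = 0) \<and>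
     isCont u 0 \<and> u 0 = 0 \<and>
     (\<exists>R\<ge>1. (\<forall>x. norm x \<ge> R \<longrightarrow> u x = 0) \<and>
        (\<forall>\<Omega>. open \<Omega> \<and> \<Omega> \<noteq> {} \<and> \<Omega> \<subseteq> ball 0 R \<longrightarrow> \<not> (AE x in lborel. x \<in> \<Omega> \<longrightarrow> u x = 0)))"

end

theory Submission
  imports Defs
begin

text \<open>For a test function \<open>v\<close> let \<open>L v\<close> denote its fractional Laplacian, written with second differences.
  Take \<open>v x = |x|\<^sup>2 exp (- 100 / (1 - |x|\<^sup>2))\<close> on the unit ball. The
  function \<open>u x = v x - 2 powr (2 s) * v (x / 2)\<close> vanishes at 0, and by scaling
  \<open>L u x = L v x - L v (x / 2)\<close> vanishes there too. Both \<open>u\<close> and \<open>L u\<close> are radial, so near 0 they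
  are \<open>|x|\<^sup>2\<close> times a function of class C1, with values at 0 of the sign of
  \<open>1 - 2 powr (2 s - 2)\<close> and of \<open>L (\<partial>\<^sub>i\<^sup>2 v) 0\<close>. The latter is positive because the second derivative
  \<open>\<partial>\<^sub>i\<^sup>2 v\<close> attains its maximum at 0. Hence the quotient \<open>L u / u\<close> is positive and C1 on a small ball,
  which is rescaled to the unit ball; one potential thus serves all three claims. Since \<open>u\<close> is itself a
  test function it lies in \<open>D\<^sup>s\<^sup>,\<^sup>2\<close>, and it vanishes only at 0, on one sphere and outside a ball.\<close>

section \<open>Rotation invariance and scaling of Lebesgue measure\<close>

text \<open>The potential is a quotient of two functions vanishing at the origin, so they must
  vanish there to the same order and with the same sign. \<open>v\<close> alone fails because the
  operator is nonlocal: \<open>v\<close> is nonnegative with \<open>v 0 = 0\<close>, hence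
  \<open>L v 0\<close> is strictly negative. A second dilate supplies the missing freedom.
  \<open>L\<close> is homogeneous of degree \<open>2 s\<close> under dilations, so
  \<open>2 powr (2 s)\<close> is the one weight that cancels \<open>L v 0\<close>. The quadratic
  terms scale by other factors and survive: the one of \<open>v\<close> is multiplied by
  \<open>1 - 2 powr (2 s - 2)\<close>, positive because \<open>s < 1\<close>, and the one of
  \<open>L v\<close> by \<open>1 - 1/4\<close>. What remains is the sign of the quadratic term of
  \<open>L v\<close>. The constant 100 serves this: for a large constant c in its place,
  \<open>v\<close> is close to a multiple of \<open>|x|^2 exp (- c |x|^2)\<close>, and with \<sigma>
  standing for \<open>c |x|^2\<close> the maximality of the second derivative along its own axis
  becomes \<open>1 - 5 \<sigma> + 2 \<sigma>^2 \<le> exp \<sigma>\<close>. This is strict for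
  \<sigma> > 0, and 100 is large enough for it to survive the correction caused by the compact
  support.\<close>

lemma nn_integral_lborel_translation:
  fixes t :: "'a::euclidean_space" and f :: "'a \<Rightarrow> ennreal"
  assumes [measurable]: "f \<in> borel_measurable borel"
  shows "(\<integral>\<^sup>+x. f (t + x) \<partial>lborel) = (\<integral>\<^sup>+x. f x \<partial>lborel)"
  by (subst (2) lborel_distr_plus[of t, symmetric]) (simp add: nn_integral_distr)

lemma integral_lborel_translation:
  fixes t :: "'a::euclidean_space" and f :: "'a \<Rightarrow> real"
  assumes [measurable]: "f \<in> borel_measurable borel"
  shows "(\<integral>x. f (t + x) \<partial>lborel) = (\<integral>x. f x \<partial>lborel)"
  by (subst (2) lborel_distr_plus[of t, symmetric]) (simp add: integral_distr)

lemma integrable_lborel_translation: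
  fixes t :: "'a::euclidean_space" and f :: "'a \<Rightarrow> real"
  assumes "integrable lborel f"
  shows "integrable lborel (\<lambda>x. f (t + x))"
proof -
  have "integrable (distr lborel borel ((+) t)) f"
    using assms by (simp add: lborel_distr_plus)
  then show ?thesis
    by (subst (asm) integrable_distr_eq) (use assms in auto)
qed

lemma integral_lborel_scale:
  fixes f :: "'a::euclidean_space \<Rightarrow> real"
  assumes c: "c > 0" and [measurable]: "f \<in> borel_measurable borel"
  shows "(\<integral>x. f (c *\<^sub>R x) \<partial>lborel) = (\<integral>x. f x \<partial>lborel) / c ^ DIM('a)"
proof -
  have "(\<integral>x. f x \<partial>lborel)
      = (\<integral>x. f x \<partial>density (distr lborel borel (\<lambda>x. 0 + c *\<^sub>R x)) (\<lambda>_. ennreal (\<bar>c\<bar> ^ DIM('a))))"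
    using lborel_affine[of c "0::'a"] c by simp
  also have "\<dots> = c ^ DIM('a) * (\<integral>x. f (c *\<^sub>R x) \<partial>lborel)"
    using c by (simp add: integral_density integral_distr)
  finally show ?thesis using c by simp
qed

text \<open>The image of Lebesgue measure under a linear isometry is translation invariant; uniqueness of
  translation-invariant measures is obtained by evaluating a double integral in two orders, and
  the constant is fixed by the unit ball.\<close>

lemma distr_lborel_isometry:
  fixes T :: "'a::euclidean_space \<Rightarrow> 'a"
  assumes T: "linear T" and n: "\<And>x. norm (T x) = norm x" and inv: "\<And>x. T (T x) = x"
  shows "distr lborel borel T = lborel"
proof -
  have [measurable]: "T \<in> borel_measurable borel"
    by (intro borel_measurable_continuous_onI linear_continuous_on linear_conv_bounded_linear[THEN iffD1] T)
  define H where "H = (indicator (ball (0::'a) 1) :: 'a \<Rightarrow> ennreal)"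
  have [measurable]: "H \<in> borel_measurable borel" unfolding H_def by (rule borel_measurable_indicator) (simp add: borel_open)
  have h: "H (T x) = H x" for x by (auto simp: H_def indicator_def n)
  have fin: "(\<integral>\<^sup>+x. H x \<partial>lborel) = emeasure lborel (ball (0::'a) 1)"
    by (simp add: H_def)
  have pos: "emeasure lborel (ball (0::'a) 1) \<noteq> 0" "emeasure lborel (ball (0::'a) 1) \<noteq> \<infinity>"
    using emeasure_lborel_ball_finite[of "0::'a" 1] content_ball_pos[of 1 "0::'a"]
    by (auto simp: measure_def)
  have "emeasure (distr lborel borel T) A = emeasure lborel A" if A: "A \<in> sets borel" for A
  proof -
    have [measurable]: "A \<in> sets borel" by fact
    define G where "G = (indicator A :: 'a \<Rightarrow> ennreal)"
    have [measurable]: "G \<in> borel_measurable borel" unfolding G_def by measurable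
    let ?K = "\<integral>\<^sup>+x. H x \<partial>lborel"
    have refl: "(\<integral>\<^sup>+y. f (- y) \<partial>lborel) = (\<integral>\<^sup>+y. f y \<partial>lborel)"
      if [measurable]: "f \<in> borel_measurable borel" for f :: "'a \<Rightarrow> ennreal"
    proof -
      have "(\<integral>\<^sup>+y. f y \<partial>lborel) = (\<integral>\<^sup>+y. f y \<partial>density (distr lborel borel (\<lambda>x. 0 + (-1) *\<^sub>R x)) (\<lambda>_. ennreal (\<bar>-1\<bar> ^ DIM('a))))"
        using lborel_affine[of "-1" "0::'a"] by simp
      then show ?thesis by (simp add: nn_integral_density nn_integral_distr)
    qed
    have "(\<integral>\<^sup>+x. G (T x) \<partial>lborel) * ?K = (\<integral>\<^sup>+x. (\<integral>\<^sup>+y. G (T x) * H y \<partial>lborel) \<partial>lborel)"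
      by (simp add: nn_integral_cmult nn_integral_multc)
    also have "\<dots> = (\<integral>\<^sup>+x. (\<integral>\<^sup>+y. G (T x) * H (T x + y) \<partial>lborel) \<partial>lborel)"
      by (intro nn_integral_cong nn_integral_lborel_translation[symmetric]) simp
    also have "\<dots> = (\<integral>\<^sup>+y. (\<integral>\<^sup>+x. G (T x) * H (T x + y) \<partial>lborel) \<partial>lborel)"
      by (rule lborel_pair.Fubini') simp
    \<comment> \<open>As \<open>T\<close> is an involution,
      \<open>T (T (- y) + x) + y = T x\<close>: after this shift the argument of \<open>H\<close> is
      free of \<open>y\<close>, and \<open>H (T x) = H x\<close>.\<close>
    also have "\<dots> = (\<integral>\<^sup>+y. (\<integral>\<^sup>+x. G (T (T (- y) + x)) * H (T (T (- y) + x) + y) \<partial>lborel) \<partial>lborel)"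
      by (intro nn_integral_cong nn_integral_lborel_translation[symmetric]) simp
    also have "\<dots> = (\<integral>\<^sup>+y. (\<integral>\<^sup>+x. G (T x - y) * H x \<partial>lborel) \<partial>lborel)"
      by (simp add: linear_add[OF T] inv h)
    also have "\<dots> = (\<integral>\<^sup>+x. (\<integral>\<^sup>+y. G (T x - y) * H x \<partial>lborel) \<partial>lborel)"
      by (rule lborel_pair.Fubini') simp
    also have "\<dots> = (\<integral>\<^sup>+x. (\<integral>\<^sup>+y. G y * H x \<partial>lborel) \<partial>lborel)"
    proof (rule nn_integral_cong)
      fix x
      have "(\<integral>\<^sup>+y. G (T x - y) * H x \<partial>lborel) = (\<integral>\<^sup>+y. G (T x + y) * H x \<partial>lborel)"
        using refl[of "\<lambda>y. G (T x + y) * H x"] by simp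
      also have "\<dots> = (\<integral>\<^sup>+y. G y * H x \<partial>lborel)"
        by (rule nn_integral_lborel_translation[of "\<lambda>y. G y * H x" "T x"]) simp
      finally show "(\<integral>\<^sup>+y. G (T x - y) * H x \<partial>lborel) = \<dots>" .
    qed
    also have "\<dots> = (\<integral>\<^sup>+x. G x \<partial>lborel) * ?K"
      by (simp add: nn_integral_cmult nn_integral_multc)
    finally have "(\<integral>\<^sup>+x. G (T x) \<partial>lborel) = (\<integral>\<^sup>+x. G x \<partial>lborel)"
      unfolding fin using pos by (simp add: mult.commute[of _ "emeasure _ (ball _ _)"] ennreal_mult_cancel_left)
    moreover have "(\<integral>\<^sup>+x. G (T x) \<partial>lborel) = (\<integral>\<^sup>+x. G x \<partial>distr lborel borel T)"
      by (simp add: nn_integral_distr)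
    ultimately show ?thesis by (simp add: G_def)
  qed
  then show ?thesis by (intro measure_eqI) auto
qed

text \<open>The Householder reflection in the hyperplane orthogonal to \<open>x - y\<close> carries
  \<open>x\<close> to \<open>y\<close>. It is an involution, as \<open>distr_lborel_isometry\<close>
  requires.\<close>

lemma exists_isometry:
  fixes x y :: "'a::euclidean_space"
  assumes "norm x = norm y"
  obtains T :: "'a \<Rightarrow> 'a" where "linear T" "\<And>z. norm (T z) = norm z" "\<And>z. T (T z) = z" "T x = y"
proof (cases "x = y")
  case True
  then show ?thesis by (intro that[of "\<lambda>z. z"]) (auto simp: linear_iff)
next
  case False
  define d where "d = x - y"
  have d: "d \<bullet> d \<noteq> 0" using False by (simp add: d_def)
  define T where "T z = z - (2 * (z \<bullet> d) / (d \<bullet> d)) *\<^sub>R d" for z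
  have xd: "2 * (x \<bullet> d) = d \<bullet> d"
    using assms unfolding d_def norm_eq by (simp add: inner_diff_left inner_diff_right inner_commute)
  show ?thesis
  proof
    show "linear T" unfolding T_def
      by (auto simp: linear_iff inner_add_left scaleR_add_left scaleR_add_right add_divide_distrib distrib_left)
        (simp add: algebra_simps)
    show "T (T z) = z" for z
      using d unfolding T_def by (simp add: inner_diff_left field_simps flip: scaleR_left_distrib)
    show "norm (T z) = norm z" for z
      unfolding norm_eq T_def using d by (simp add: inner_diff_left inner_diff_right inner_commute field_simps)
    show "T x = y" unfolding T_def xd using d by (simp add: d_def)
  qed
qed

section \<open>Integrability of the truncated kernel\<close>

lemma dyadic_small:
  fixes r :: real
  assumes "0 < r" "r < 1"
  obtains n :: nat where "2 powr (- (real n + 1)) \<le> r" "r < 2 powr (- real n)"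
proof
  let ?n = "nat (\<lceil>- log 2 r\<rceil> - 1)"
  have l: "- log 2 r > 0" using assms by simp
  then have "real ?n = of_int \<lceil>- log 2 r\<rceil> - 1" by simp
  then have "real ?n < - log 2 r" "- log 2 r \<le> real ?n + 1" by linarith+
  then have "- (real ?n + 1) \<le> log 2 r" "log 2 r < - real ?n" by linarith+
  then show "2 powr (- (real ?n + 1)) \<le> r" "r < 2 powr (- real ?n)"
    using assms le_log_iff[of 2 r] log_less_iff[of 2 r] by auto
qed

lemma dyadic_large:
  fixes r :: real
  assumes "1 \<le> r"
  obtains n :: nat where "2 powr (real n) \<le> r" "r < 2 powr (real n + 1)"
proof
  let ?n = "nat \<lfloor>log 2 r\<rfloor>"
  have "log 2 r \<ge> 0" using assms by simp
  then have "real ?n \<le> log 2 r" "log 2 r < real ?n + 1" by linarith+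
  then show "2 powr (real ?n) \<le> r" "r < 2 powr (real ?n + 1)"
    using assms le_log_iff[of 2 r "real ?n"] log_less_iff[of 2 r "real ?n + 1"] by linarith+
qed

lemma nn_integral_ball_series:
  fixes c r :: "nat \<Rightarrow> real"
  assumes c: "\<And>n. c n \<ge> 0" and r: "\<And>n. r n \<ge> 0"
    and sm: "summable (\<lambda>n. c n * r n ^ DIM('a::euclidean_space))"
  shows "(\<integral>\<^sup>+x. (\<Sum>n. ennreal (c n) * indicator (ball (0::'a) (r n)) x) \<partial>lborel) < \<infinity>"
proof -
  have [measurable]: "ball (0::'a) (r n) \<in> sets borel" for n by (simp add: borel_open)
  have "(\<integral>\<^sup>+x. (\<Sum>n. ennreal (c n) * indicator (ball (0::'a) (r n)) x) \<partial>lborel)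
      = (\<Sum>n. ennreal (c n) * emeasure lborel (ball (0::'a) (r n)))"
    by (subst nn_integral_suminf) (simp_all add: nn_integral_cmult_indicator)
  also have "\<dots> = (\<Sum>n. ennreal (unit_ball_vol (real DIM('a)) * (c n * r n ^ DIM('a))))"
    by (intro suminf_cong) (simp add: emeasure_ball r c ennreal_mult'[symmetric] mult_ac)
  also have "\<dots> < \<infinity>"
    using summable_mult[OF sm] c r
    by (subst suminf_ennreal2) (auto intro!: mult_nonneg_nonneg)
  finally show ?thesis .
qed

text \<open>On each dyadic shell the kernel is bounded by a constant, and the shell is enlarged to a
  ball. The resulting series are geometric: the ratio is \<open>2 powr (- (2 - 2 * s))\<close> near
  the origin and \<open>2 powr (- (2 * s))\<close> at infinity, so the two ends use
  \<open>s < 1\<close> and \<open>s > 0\<close> respectively.\<close>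

lemma integrable_truncated_kernel:
  fixes s :: real
  assumes s: "0 < s" "s < 1"
  shows "integrable lborel (\<lambda>z::'a::euclidean_space. min 1 ((norm z)\<^sup>2) / norm z powr (real DIM('a) + 2 * s))"
    (is "integrable lborel ?k")
proof (rule integrableI_nonneg)
  let ?N = "real DIM('a)"
  \<comment> \<open>On the shell between \<open>2 powr (- (n + 1))\<close> and
    \<open>2 powr (- n)\<close>, the negative power of the norm is largest at the inner radius and
    the positive power \<open>2 - 2 * s\<close> at the outer one; \<open>a n\<close> is the product
    of these two values.\<close>
  define a where "a n = 2 powr ((real n + 1) * ?N - real n * (2 - 2 * s))" for n :: nat
  define b where "b n = 2 powr (- (real n * (?N + 2 * s)))" for n :: nat
  let ?A = "\<lambda>z. \<Sum>n. ennreal (a n) * indicator (ball (0::'a) (2 powr (- real n))) z"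
  let ?B = "\<lambda>z. \<Sum>n. ennreal (b n) * indicator (ball (0::'a) (2 powr (real n + 1))) z"
  have [measurable]: "ball (0::'a) q \<in> sets borel" for q by (simp add: borel_open)
  have single: "f n \<le> (\<Sum>n. f n)" for f :: "nat \<Rightarrow> ennreal" and n
    using sum_le_suminf[of f "{n}"] by simp
  have bound: "ennreal (?k z) \<le> ?A z + ?B z" for z
  proof (cases "z = 0")
    case False
    then have z: "norm z > 0" by simp
    show ?thesis
    proof (cases "norm z < 1")
      case True
      obtain n where n: "2 powr (- (real n + 1)) \<le> norm z" "norm z < 2 powr (- real n)"
        using dyadic_small[OF z True] .
      have "?k z \<le> (norm z)\<^sup>2 / norm z powr (?N + 2 * s)"
        by (intro divide_right_mono) auto
      also have "\<dots> = norm z powr (- ?N) * norm z powr (2 - 2 * s)"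
        using z by (simp add: powr_add[symmetric] powr_diff[symmetric] powr_numeral[symmetric] algebra_simps del: powr_numeral)
      also have "\<dots> \<le> (2 powr (- (real n + 1))) powr (- ?N) * (2 powr (- real n)) powr (2 - 2 * s)"
        using n z s by (intro mult_mono powr_mono2' powr_mono2) auto
      also have "\<dots> = a n"
        unfolding a_def powr_powr powr_add[symmetric] by (simp add: algebra_simps)
      finally have "ennreal (?k z) \<le> ennreal (a n) * indicator (ball (0::'a) (2 powr (- real n))) z"
        using n by (auto intro!: ennreal_leI)
      also have "\<dots> \<le> ?A z" by (rule single)
      also have "\<dots> \<le> ?A z + ?B z" by simp
      finally show ?thesis .
    next
      case False
      then obtain n where n: "2 powr (real n) \<le> norm z" "norm z < 2 powr (real n + 1)"
        using dyadic_large[of "norm z"] by auto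
      have "?k z \<le> 1 / norm z powr (?N + 2 * s)"
        by (intro divide_right_mono) auto
      also have "\<dots> = norm z powr (- (?N + 2 * s))"
        by (simp only: powr_minus_divide)
      also have "\<dots> \<le> (2 powr (real n)) powr (- (?N + 2 * s))"
        using n z s by (intro powr_mono2') auto
      also have "\<dots> = b n"
        unfolding b_def powr_powr by (simp add: algebra_simps)
      finally have "ennreal (?k z) \<le> ennreal (b n) * indicator (ball (0::'a) (2 powr (real n + 1))) z"
        using n by (auto intro!: ennreal_leI)
      also have "\<dots> \<le> ?B z" by (rule single)
      also have "\<dots> \<le> ?A z + ?B z" by simp
      finally show ?thesis .
    qed
  qed simp
  have "(\<integral>\<^sup>+z. ?A z + ?B z \<partial>lborel) = (\<integral>\<^sup>+z. ?A z \<partial>lborel) + (\<integral>\<^sup>+z. ?B z \<partial>lborel)"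
    by (rule nn_integral_add) measurable
  also have "\<dots> < \<infinity>"
  proof -
    have "(\<lambda>n. a n * (2 powr (- real n)) ^ DIM('a)) = (\<lambda>n. 2 ^ DIM('a) * (2 powr (- (2 - 2 * s))) ^ n)"
      by (rule ext) (simp add: a_def powr_realpow[symmetric] powr_powr powr_add[symmetric] algebra_simps del: powr_realpow)
    moreover have "summable (\<lambda>n. 2 ^ DIM('a) * (2 powr (- (2 - 2 * s)) :: real) ^ n)"
      using s by (intro summable_mult summable_geometric) (auto intro!: powr_less_one)
    ultimately have "summable (\<lambda>n. a n * (2 powr (- real n)) ^ DIM('a))" by simp
    then have 1: "(\<integral>\<^sup>+z. ?A z \<partial>lborel) < \<infinity>"
      by (intro nn_integral_ball_series) (auto simp: a_def)
    have "(\<lambda>n. b n * (2 powr (real n + 1)) ^ DIM('a)) = (\<lambda>n. 2 ^ DIM('a) * (2 powr (- (2 * s))) ^ n)"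
      by (rule ext) (simp add: b_def powr_realpow[symmetric] powr_powr powr_add[symmetric] algebra_simps del: powr_realpow)
    moreover have "summable (\<lambda>n. 2 ^ DIM('a) * (2 powr (- (2 * s)) :: real) ^ n)"
      using s by (intro summable_mult summable_geometric) (auto intro!: powr_less_one)
    ultimately have "summable (\<lambda>n. b n * (2 powr (real n + 1)) ^ DIM('a))" by simp
    then have 2: "(\<integral>\<^sup>+z. ?B z \<partial>lborel) < \<infinity>"
      by (intro nn_integral_ball_series) (auto simp: b_def)
    from 1 2 show ?thesis by (simp add: ennreal_add_less_top)
  qed
  finally have "(\<integral>\<^sup>+z. ?A z + ?B z \<partial>lborel) < \<infinity>" .
  then show "(\<integral>\<^sup>+z. ennreal (?k z) \<partial>lborel) < \<infinity>"
    by (rule order.strict_trans1[rotated]) (intro nn_integral_mono bound)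
qed auto

section \<open>Calculus of test functions\<close>

definition pd :: "'a::euclidean_space \<Rightarrow> ('a \<Rightarrow> real) \<Rightarrow> 'a \<Rightarrow> real" where
  "pd i f x = frechet_derivative f (at x) i"

lemma Ck_fun_Suc_pd:
  "Ck_fun (Suc k) f \<longleftrightarrow> f differentiable_on UNIV \<and> (\<forall>i\<in>Basis. Ck_fun k (pd i f))"
  by (simp add: pd_def[abs_def])

lemma smooth_fun_pd: "smooth_fun f \<Longrightarrow> i \<in> Basis \<Longrightarrow> smooth_fun (pd i f)"
  unfolding smooth_fun_def using Ck_fun_Suc_pd by blast

lemma smooth_fun_continuous: "smooth_fun f \<Longrightarrow> continuous_on UNIV f"
  unfolding smooth_fun_def using Ck_fun.simps(1) by blast

lemma smooth_fun_differentiable: "smooth_fun f \<Longrightarrow> f differentiable (at x)"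
  unfolding smooth_fun_def using Ck_fun_Suc_pd[of 0 f] by (auto simp: differentiable_on_def)

lemma differentiable_has_derivative_pd:
  fixes f :: "'a::euclidean_space \<Rightarrow> real"
  assumes "f differentiable (at x)"
  shows "(f has_derivative (\<lambda>h. \<Sum>i\<in>Basis. (h \<bullet> i) * pd i f x)) (at x)"
proof -
  let ?D = "frechet_derivative f (at x)"
  have D: "(f has_derivative ?D) (at x)"
    using assms by (simp add: frechet_derivative_works)
  then have "linear ?D" by (rule has_derivative_linear)
  have "?D h = (\<Sum>i\<in>Basis. (h \<bullet> i) * pd i f x)" for h
  proof -
    have "?D h = ?D (\<Sum>i\<in>Basis. (h \<bullet> i) *\<^sub>R i)"
      by (simp only: euclidean_representation)
    also have "\<dots> = (\<Sum>i\<in>Basis. ?D ((h \<bullet> i) *\<^sub>R i))"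
      using \<open>linear ?D\<close> by (rule linear_sum)
    also have "\<dots> = (\<Sum>i\<in>Basis. (h \<bullet> i) * pd i f x)"
      unfolding pd_def using linear_scale[OF \<open>linear ?D\<close>] by simp
    finally show ?thesis .
  qed
  then have "?D = (\<lambda>h. \<Sum>i\<in>Basis. (h \<bullet> i) * pd i f x)" by (rule ext)
  then show ?thesis using D by metis
qed

lemma pd_eqI:
  fixes f :: "'a::euclidean_space \<Rightarrow> real"
  assumes "(f has_derivative (\<lambda>h. \<Sum>i\<in>Basis. (h \<bullet> i) * g i x)) (at x)" "i \<in> Basis"
  shows "pd i f x = g i x"
proof -
  have "pd i f x = (\<Sum>j\<in>Basis. (i \<bullet> j) * g j x)"
    using frechet_derivative_at[OF assms(1)] unfolding pd_def by metis
  also have "\<dots> = (\<Sum>j\<in>Basis. if j = i then g j x else 0)"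
    using assms(2) by (intro sum.cong) (auto simp: inner_Basis)
  finally show ?thesis using assms(2) by simp
qed

lemma has_real_derivative_line:
  fixes f :: "'a::euclidean_space \<Rightarrow> real"
  assumes "f differentiable (at (x + t *\<^sub>R h))"
  shows "((\<lambda>t. f (x + t *\<^sub>R h)) has_real_derivative (\<Sum>i\<in>Basis. (h \<bullet> i) * pd i f (x + t *\<^sub>R h))) (at t)"
proof -
  have "((\<lambda>t. x + t *\<^sub>R h) has_derivative (\<lambda>d. d *\<^sub>R h)) (at t)"
    by (auto intro!: derivative_eq_intros)
  from has_derivative_compose[OF this differentiable_has_derivative_pd[OF assms]]
  show ?thesis
    unfolding has_field_derivative_def
    by (rule has_derivative_eq_rhs) (simp add: fun_eq_iff sum_distrib_left mult_ac)
qed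

lemma test_fun_zero_outside:
  fixes f :: "'a::euclidean_space \<Rightarrow> real"
  assumes "test_fun U f"
  obtains R where "R > 0" "\<And>x. norm x > R \<Longrightarrow> f x = 0"
proof -
  have "bounded (tsupp f)" using assms by (simp add: test_fun_def compact_imp_bounded)
  then obtain R where R: "\<And>x. x \<in> tsupp f \<Longrightarrow> norm x \<le> R"
    unfolding bounded_iff by blast
  show ?thesis
  proof (rule that[of "max R 1"])
    fix x :: 'a assume "norm x > max R 1"
    then have "x \<notin> tsupp f" using R[of x] by auto
    then show "f x = 0" unfolding tsupp_def using closure_subset[of "{x. f x \<noteq> 0}"] by auto
  qed simp
qed

lemma test_funI:
  fixes f :: "'a::euclidean_space \<Rightarrow> real"
  assumes "smooth_fun f" "\<And>x. norm x > R \<Longrightarrow> f x = 0"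
  shows "test_fun UNIV f"
proof -
  have "{x. f x \<noteq> 0} \<subseteq> cball 0 R" using assms(2) by (auto simp: mem_cball dist_norm) (metis not_less)
  then have "bounded (closure {x. f x \<noteq> 0})" by (intro bounded_closure) (rule bounded_subset[OF bounded_cball])
  then show ?thesis using assms(1) by (simp add: test_fun_def tsupp_def compact_eq_bounded_closed)
qed

lemma test_fun_pd:
  fixes f :: "'a::euclidean_space \<Rightarrow> real"
  assumes f: "test_fun U f" and i: "i \<in> Basis"
  shows "test_fun UNIV (pd i f)"
proof -
  obtain R where R: "R > 0" "\<And>x. norm x > R \<Longrightarrow> f x = 0"
    using test_fun_zero_outside[OF f] by blast
  show ?thesis
  proof (rule test_funI)
    show "smooth_fun (pd i f)" using f i by (simp add: test_fun_def smooth_fun_pd)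
    fix x :: 'a assume x: "norm x > R"
    have "(f has_derivative (\<lambda>h. \<Sum>j\<in>Basis. (h \<bullet> j) * 0)) (at x)"
    proof (rule has_derivative_transform_within_open)
      show "((\<lambda>x. 0) has_derivative (\<lambda>h. \<Sum>j\<in>Basis. (h \<bullet> j) * 0)) (at x)" by simp
      show "open (- cball (0::'a) R)" by (simp add: open_Compl)
    qed (use x R in auto)
    from pd_eqI[OF this i] show "pd i f x = 0" by simp
  qed
qed

lemma test_fun_bounded:
  fixes f :: "'a::euclidean_space \<Rightarrow> real"
  assumes f: "test_fun U f"
  obtains B where "B > 0" "\<And>x. \<bar>f x\<bar> \<le> B"
proof -
  obtain R where R: "R > 0" "\<And>x. norm x > R \<Longrightarrow> f x = 0"
    using test_fun_zero_outside[OF f] by blast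
  have "continuous_on (cball 0 R) f"
    using f smooth_fun_continuous continuous_on_subset unfolding test_fun_def by blast
  then have "bounded (f ` cball 0 R)"
    by (intro compact_imp_bounded compact_continuous_image) auto
  then obtain B where "\<forall>y\<in>f ` cball 0 R. norm y \<le> B" unfolding bounded_iff by blast
  then have B: "\<And>x. x \<in> cball 0 R \<Longrightarrow> \<bar>f x\<bar> \<le> B" by auto
  show ?thesis
  proof (rule that[of "max B 1"])
    fix x show "\<bar>f x\<bar> \<le> max B 1"
      using B[of x] R(2)[of x] by (cases "norm x > R") auto
  qed simp
qed

lemma test_fun_lipschitz:
  fixes f :: "'a::euclidean_space \<Rightarrow> real"
  assumes f: "test_fun U f"
  obtains K where "K > 0" "\<And>x y. \<bar>f x - f y\<bar> \<le> K * norm (x - y)"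
proof -
  have "\<exists>B>0. \<forall>x. \<bar>pd i f x\<bar> \<le> B" if "i \<in> Basis" for i :: 'a
    using test_fun_bounded[OF test_fun_pd[OF f that]] by metis
  then obtain B where B: "\<And>i. i \<in> Basis \<Longrightarrow> B i > 0" "\<And>i x. i \<in> Basis \<Longrightarrow> \<bar>pd i f x\<bar> \<le> B i"
    by metis
  define K where "K = (\<Sum>i\<in>(Basis::'a set). B i)"
  have K: "K > 0" unfolding K_def using B(1) by (intro sum_pos) auto
  have "norm (f x - f y) \<le> K * norm (x - y)" for x y
  proof (rule differentiable_bound[where S=UNIV])
    fix x :: 'a
    show "(f has_derivative (\<lambda>h. \<Sum>i\<in>Basis. (h \<bullet> i) * pd i f x)) (at x within UNIV)"
      using f by (simp add: differentiable_has_derivative_pd smooth_fun_differentiable test_fun_def)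
    show "onorm (\<lambda>h. \<Sum>i\<in>Basis. (h \<bullet> i) * pd i f x) \<le> K"
    proof (rule onorm_bound)
      show "0 \<le> K" using K by simp
      fix h :: 'a
      have "norm (\<Sum>i\<in>Basis. (h \<bullet> i) * pd i f x) \<le> (\<Sum>i\<in>(Basis::'a set). norm h * B i)"
        by (intro sum_norm_le) (auto simp: abs_mult intro!: mult_mono B Basis_le_norm)
      then show "norm (\<Sum>i\<in>Basis. (h \<bullet> i) * pd i f x) \<le> K * norm h"
        unfolding K_def sum_distrib_right by (simp add: mult.commute)
    qed
  qed auto
  then show ?thesis using that[OF K] by simp
qed

text \<open>The sign is that of the negative Laplacian: the second difference is nonnegative where
  \<open>f\<close> has a global maximum.\<close>

definition diff2 :: "('a::real_vector \<Rightarrow> real) \<Rightarrow> 'a \<Rightarrow> 'a \<Rightarrow> real" where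
  "diff2 f x z = 2 * f x - f (x + z) - f (x - z)"

text \<open>Along \<open>t\<close> the symmetrized function \<open>f (x + t z) + f (x - t z)\<close>
  has as derivative a difference of gradients at points \<open>2 t |z|\<close> apart. Lipschitz
  gradients thus give a second power of \<open>|z|\<close>; boundedness of \<open>f\<close> gives
  the cap for large \<open>z\<close>.\<close>

lemma test_fun_diff2_bound:
  fixes f :: "'a::euclidean_space \<Rightarrow> real"
  assumes f: "test_fun U f"
  obtains K where "K > 0" "\<And>x z. \<bar>diff2 f x z\<bar> \<le> K * min 1 ((norm z)\<^sup>2)"
proof -
  obtain B where B: "B > 0" "\<And>x. \<bar>f x\<bar> \<le> B" using test_fun_bounded[OF f] by blast
  have "\<exists>L>0. \<forall>x y. \<bar>pd i f x - pd i f y\<bar> \<le> L * norm (x - y)" if "i \<in> Basis" for i :: 'a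
    using test_fun_lipschitz[OF test_fun_pd[OF f that]] by metis
  then obtain L where L: "\<And>i. i \<in> Basis \<Longrightarrow> L i > 0"
      "\<And>i x y. i \<in> Basis \<Longrightarrow> \<bar>pd i f x - pd i f y\<bar> \<le> L i * norm (x - y)"
    by metis
  define K where "K = (\<Sum>i\<in>(Basis::'a set). 2 * L i)"
  have K: "K > 0" unfolding K_def using L(1) by (intro sum_pos) auto
  have diff: "f differentiable (at x)" for x
    using f by (simp add: smooth_fun_differentiable test_fun_def)
  have 1: "\<bar>diff2 f x z\<bar> \<le> K * (norm z)\<^sup>2" for x z
  proof -
    define \<psi> where "\<psi> t = f (x + t *\<^sub>R z) + f (x + t *\<^sub>R (- z))" for t
    define \<psi>' where "\<psi>' t = (\<Sum>i\<in>Basis. (z \<bullet> i) * pd i f (x + t *\<^sub>R z))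
       + (\<Sum>i\<in>Basis. (- z \<bullet> i) * pd i f (x + t *\<^sub>R (- z)))" for t
    have d: "(\<psi> has_real_derivative \<psi>' t) (at t)" for t
      unfolding \<psi>_def \<psi>'_def by (intro DERIV_add has_real_derivative_line diff)
    obtain t where t: "0 < t" "t < 1" "\<psi> 1 - \<psi> 0 = (1 - 0) * \<psi>' t"
      using MVT2[of 0 1 \<psi> \<psi>'] d by auto
    have "\<psi>' t = (\<Sum>i\<in>Basis. (z \<bullet> i) * (pd i f (x + t *\<^sub>R z) - pd i f (x + t *\<^sub>R (- z))))"
      unfolding \<psi>'_def by (simp add: sum.distrib[symmetric] algebra_simps sum_subtractf sum_negf)
    then have "\<bar>\<psi>' t\<bar> \<le> (\<Sum>i\<in>(Basis::'a set). (norm z)\<^sup>2 * (2 * L i))"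
    proof (simp only: real_norm_def[symmetric], intro sum_norm_le)
      fix i :: 'a assume i: "i \<in> Basis"
      have "norm (x + t *\<^sub>R z - (x + t *\<^sub>R (- z))) = norm ((2 * t) *\<^sub>R z)"
        by (simp add: algebra_simps scaleR_2[symmetric])
      also have "\<dots> = 2 * t * norm z" using t by simp
      also have "\<dots> \<le> 2 * norm z"
        using t mult_right_mono[of t 1 "norm z"] by simp
      finally have n: "norm (x + t *\<^sub>R z - (x + t *\<^sub>R (- z))) \<le> 2 * norm z" .
      have "\<bar>pd i f (x + t *\<^sub>R z) - pd i f (x + t *\<^sub>R (- z))\<bar> \<le> L i * (2 * norm z)"
        using order_trans[OF L(2)[OF i] mult_left_mono[OF n]] L(1)[OF i] by simp
      then have "\<bar>z \<bullet> i\<bar> * \<bar>pd i f (x + t *\<^sub>R z) - pd i f (x + t *\<^sub>R (- z))\<bar> \<le> norm z * (L i * (2 * norm z))"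
        by (intro mult_mono Basis_le_norm i) auto
      then show "norm ((z \<bullet> i) * (pd i f (x + t *\<^sub>R z) - pd i f (x + t *\<^sub>R (- z)))) \<le> (norm z)\<^sup>2 * (2 * L i)"
        by (simp add: abs_mult power2_eq_square mult_ac)
    qed
    also have "\<dots> = K * (norm z)\<^sup>2" unfolding K_def sum_distrib_right by (simp add: mult.commute)
    finally show ?thesis using t(3) by (simp add: \<psi>_def diff2_def abs_minus_commute algebra_simps)
  qed
  have 2: "\<bar>diff2 f x z\<bar> \<le> 4 * B" for x z
    using B(2)[of x] B(2)[of "x+z"] B(2)[of "x-z"] unfolding diff2_def by linarith
  show ?thesis
  proof (rule that[of "K + 4 * B"])
    fix x z
    show "\<bar>diff2 f x z\<bar> \<le> (K + 4 * B) * min 1 ((norm z)\<^sup>2)"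
    proof (cases "(norm z)\<^sup>2 \<le> 1")
      case True
      have "\<bar>diff2 f x z\<bar> \<le> (K + 4 * B) * (norm z)\<^sup>2"
        by (rule order_trans[OF 1]) (use B in \<open>auto intro!: mult_right_mono\<close>)
      then show ?thesis using True by (simp add: min_def)
    qed (use 2[of x z] K in \<open>auto simp: min_def\<close>)
  qed (use K B in auto)
qed

lemma pd_lincomb:
  fixes f g :: "'a::euclidean_space \<Rightarrow> real"
  assumes f: "f differentiable_on UNIV" and g: "g differentiable_on UNIV" and i: "i \<in> Basis"
  shows "(\<lambda>x. a * f (c *\<^sub>R x) + b * g (d *\<^sub>R x)) differentiable_on UNIV"
    and "pd i (\<lambda>x. a * f (c *\<^sub>R x) + b * g (d *\<^sub>R x))
           = (\<lambda>x. (a * c) * pd i f (c *\<^sub>R x) + (b * d) * pd i g (d *\<^sub>R x))"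
proof -
  have s: "((\<lambda>x. h (c *\<^sub>R x)) has_derivative (\<lambda>k. c * (\<Sum>i\<in>Basis. (k \<bullet> i) * pd i h (c *\<^sub>R x)))) (at x)"
    if "h differentiable_on UNIV" for h :: "'a \<Rightarrow> real" and c x
  proof -
    have "(h has_derivative (\<lambda>k. \<Sum>i\<in>Basis. (k \<bullet> i) * pd i h (c *\<^sub>R x))) (at (c *\<^sub>R x))"
      using that by (intro differentiable_has_derivative_pd) (auto simp: differentiable_on_def)
    moreover have "((\<lambda>x. c *\<^sub>R x) has_derivative (\<lambda>k. c *\<^sub>R k)) (at x)"
      by (auto intro!: derivative_eq_intros)
    ultimately have "((\<lambda>x. h (c *\<^sub>R x)) has_derivative
        (\<lambda>k. \<Sum>i\<in>Basis. (c *\<^sub>R k \<bullet> i) * pd i h (c *\<^sub>R x))) (at x)"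
      by (rule has_derivative_compose[rotated])
    then show ?thesis by (simp add: sum_distrib_left mult_ac)
  qed
  have D: "((\<lambda>x. a * f (c *\<^sub>R x) + b * g (d *\<^sub>R x)) has_derivative
      (\<lambda>k. \<Sum>i\<in>Basis. (k \<bullet> i) * ((a * c) * pd i f (c *\<^sub>R x) + (b * d) * pd i g (d *\<^sub>R x)))) (at x)" for x
    by (rule has_derivative_eq_rhs, rule has_derivative_add[OF has_derivative_mult_right[OF s[OF f]] has_derivative_mult_right[OF s[OF g]]])
       (simp add: sum_distrib_left sum.distrib algebra_simps)
  show "(\<lambda>x. a * f (c *\<^sub>R x) + b * g (d *\<^sub>R x)) differentiable_on UNIV"
    using D unfolding differentiable_on_def differentiable_def by blast
  show "pd i (\<lambda>x. a * f (c *\<^sub>R x) + b * g (d *\<^sub>R x))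
           = (\<lambda>x. (a * c) * pd i f (c *\<^sub>R x) + (b * d) * pd i g (d *\<^sub>R x))"
    by (rule ext, rule pd_eqI[where g="\<lambda>i x. (a * c) * pd i f (c *\<^sub>R x) + (b * d) * pd i g (d *\<^sub>R x)", OF D i])
qed

text \<open>The dilations belong to the statement because the solution combines two dilates. The
  shape is stable under differentiation, with \<open>a\<close> and \<open>b\<close> replaced by
  \<open>a * c\<close> and \<open>b * d\<close>, which is why the induction generalizes over the
  coefficients.\<close>

lemma Ck_fun_lincomb:
  "Ck_fun k f \<Longrightarrow> Ck_fun k g \<Longrightarrow> Ck_fun k (\<lambda>x. a * f (c *\<^sub>R x) + b * g (d *\<^sub>R x))"
proof (induction k arbitrary: f g a b)
  case 0
  then have *: "continuous_on UNIV f" "continuous_on UNIV g" by auto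
  have "continuous_on UNIV (\<lambda>x. f (c *\<^sub>R x))" "continuous_on UNIV (\<lambda>x. g (d *\<^sub>R x))"
    by (rule continuous_on_compose2[OF *(1)] continuous_on_compose2[OF *(2)];
        auto intro!: continuous_intros)+
  then show ?case by (auto intro!: continuous_intros)
next
  case (Suc k)
  then show ?case unfolding Ck_fun_Suc_pd using pd_lincomb[of f g] pd_lincomb(1)[of f g, OF _ _ SOME_Basis] by auto
qed

lemma smooth_fun_lincomb:
  "smooth_fun f \<Longrightarrow> smooth_fun g \<Longrightarrow> smooth_fun (\<lambda>x. a * f (c *\<^sub>R x) + b * g (d *\<^sub>R x))"
  unfolding smooth_fun_def using Ck_fun_lincomb by blast

lemma test_fun_lincomb:
  fixes f g :: "'a::euclidean_space \<Rightarrow> real"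
  assumes f: "test_fun UNIV f" and g: "test_fun UNIV g" and "c > 0" "d > 0"
  shows "test_fun UNIV (\<lambda>x. a * f (c *\<^sub>R x) + b * g (d *\<^sub>R x))"
proof -
  obtain R where R: "R > 0" "\<And>x. norm x > R \<Longrightarrow> f x = 0"
    using test_fun_zero_outside[OF f] by blast
  obtain S where S: "S > 0" "\<And>x. norm x > S \<Longrightarrow> g x = 0"
    using test_fun_zero_outside[OF g] by blast
  show ?thesis
  proof (rule test_funI)
    show "smooth_fun (\<lambda>x. a * f (c *\<^sub>R x) + b * g (d *\<^sub>R x))"
      using f g by (intro smooth_fun_lincomb) (auto simp: test_fun_def)
    fix x :: 'a assume "norm x > max (R / c) (S / d)"
    then show "a * f (c *\<^sub>R x) + b * g (d *\<^sub>R x) = 0"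
      using R(2)[of "c *\<^sub>R x"] S(2)[of "d *\<^sub>R x"] assms(3,4) by (auto simp: field_simps)
  qed
qed

section \<open>The fractional Laplacian of a test function\<close>

definition trunc_kernel :: "real \<Rightarrow> 'a::euclidean_space \<Rightarrow> real" where
  "trunc_kernel s z = min 1 ((norm z)\<^sup>2) / norm z powr (real DIM('a) + 2 * s)"

text \<open>Up to the normalising factor \<open>C_Ns N s / 2\<close> this is the fractional Laplacian \<open>(-\<Delta>)^s f\<close>; the second
  difference makes the integral absolutely convergent.\<close>

definition frac_lap :: "real \<Rightarrow> ('a::euclidean_space \<Rightarrow> real) \<Rightarrow> 'a \<Rightarrow> real" where
  "frac_lap s f x = (\<integral>z. diff2 f x z / norm z powr (real DIM('a) + 2 * s) \<partial>lborel)"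

lemma trunc_kernel_nonneg: "trunc_kernel s z \<ge> 0"
  by (simp add: trunc_kernel_def)

lemma trunc_kernel_measurable [measurable]: "trunc_kernel s \<in> borel_measurable borel"
  unfolding trunc_kernel_def[abs_def] by measurable

lemma test_fun_measurable: "test_fun U f \<Longrightarrow> f \<in> borel_measurable borel"
  by (intro borel_measurable_continuous_onI smooth_fun_continuous) (simp add: test_fun_def)

text \<open>An explicit remainder bound can be integrated in a parameter, so this replaces a limit
  theorem when \<open>frac_lap\<close> is differentiated under the integral. It also settles the
  derivative of \<open>flat\<close> at 0.\<close>

lemma DERIV_quadratic_remainder:
  fixes f :: "real \<Rightarrow> real"
  assumes C: "\<And>h. \<bar>f (x + h) - f x - h * D\<bar> \<le> C * h\<^sup>2"
  shows "(f has_real_derivative D) (at x)"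
  unfolding DERIV_def
proof (rule Lim_null_comparison[where g="\<lambda>h. C * \<bar>h\<bar>", THEN LIM_zero_cancel])
  show "\<forall>\<^sub>F h in at 0. norm ((f (x + h) - f x) / h - D) \<le> C * \<bar>h\<bar>"
  proof (unfold eventually_at_filter, intro always_eventually allI impI)
    fix h :: real assume h: "h \<noteq> 0"
    have "(f (x + h) - f x) / h - D = (f (x + h) - f x - h * D) / h"
      using h by (simp add: field_simps)
    also have "norm \<dots> \<le> (C * h\<^sup>2) / \<bar>h\<bar>"
      using C[of h] by (simp add: divide_right_mono)
    also have "\<dots> = C * \<bar>h\<bar>"
      using h by (cases "h > 0") (auto simp: power2_eq_square)
    finally show "norm ((f (x + h) - f x) / h - D) \<le> C * \<bar>h\<bar>" .
  qed
  show "((\<lambda>h. C * \<bar>h\<bar>) \<longlongrightarrow> 0) (at 0)"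
    by (auto intro!: tendsto_eq_intros)
qed

lemma test_fun_pd_funpow: "test_fun UNIV f \<Longrightarrow> i \<in> Basis \<Longrightarrow> test_fun UNIV ((pd i ^^ m) f)"
  by (induction m) (auto intro: test_fun_pd)

lemma test_fun_DERIV_pd:
  assumes f: "test_fun U f" and i: "i \<in> Basis"
  shows "((\<lambda>t. f (x + t *\<^sub>R i)) has_real_derivative pd i f (x + t *\<^sub>R i)) (at t)"
proof -
  have "(\<Sum>j\<in>Basis. (i \<bullet> j) * pd j f y) = pd i f y" for y
    using i by (simp add: inner_Basis if_distrib[of "\<lambda>a. a * _"] cong: if_cong)
  then show ?thesis
    using has_real_derivative_line[of f x t i] f
    by (simp add: test_fun_def smooth_fun_differentiable)
qed

lemma DERIV_diff2:
  assumes f: "test_fun U f" and i: "i \<in> Basis"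
  shows "((\<lambda>t. diff2 f (x + t *\<^sub>R i) z) has_real_derivative diff2 (pd i f) (x + t *\<^sub>R i) z) (at t)"
proof -
  have *: "x + t *\<^sub>R i + z = (x + z) + t *\<^sub>R i" "x + t *\<^sub>R i - z = (x - z) + t *\<^sub>R i" for t
    by simp_all
  show ?thesis unfolding diff2_def *
    by (intro DERIV_diff DERIV_cmult test_fun_DERIV_pd[OF f i])
qed

lemma diff2_measurable:
  fixes f :: "'a::euclidean_space \<Rightarrow> real"
  assumes [measurable]: "f \<in> borel_measurable borel"
  shows "diff2 f x \<in> borel_measurable borel"
  unfolding diff2_def[abs_def] by measurable

text \<open>Substitute \<open>T z\<close> for \<open>z\<close>, where the reflection
  \<open>T\<close> carries \<open>x\<close> to \<open>y\<close>: it preserves the kernel, the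
  measure and \<open>f\<close>, and turns the second difference at \<open>y\<close> into that at
  \<open>x\<close>.\<close>

lemma frac_lap_radial:
  fixes f :: "'a::euclidean_space \<Rightarrow> real"
  assumes f: "test_fun U f" and r: "radial f"
  shows "radial (frac_lap s f)"
  unfolding radial_def
proof (intro allI impI)
  fix x y :: 'a assume "norm x = norm y"
  then obtain T :: "'a \<Rightarrow> 'a" where T: "linear T" "\<And>z. norm (T z) = norm z" "\<And>z. T (T z) = z" "T x = y"
    using exists_isometry by blast
  have [measurable]: "T \<in> borel_measurable borel"
    by (intro borel_measurable_continuous_onI linear_continuous_on linear_conv_bounded_linear[THEN iffD1] T)
  have [measurable]: "diff2 f y \<in> borel_measurable borel"
    by (intro diff2_measurable test_fun_measurable[OF f])
  have fT: "f (T z) = f z" for z using r T(2) unfolding radial_def by blast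
  have d: "diff2 f y (T z) = diff2 f x z" for z
    unfolding diff2_def T(4)[symmetric] using fT[of x] fT[of "x + z"] fT[of "x - z"]
    by (simp add: linear_add[OF T(1)] linear_diff[OF T(1)])
  have "frac_lap s f y = (\<integral>z. diff2 f y z / norm z powr (real DIM('a) + 2 * s) \<partial>distr lborel borel T)"
    unfolding frac_lap_def by (simp add: distr_lborel_isometry[OF T(1-3)])
  also have "\<dots> = frac_lap s f x"
    unfolding frac_lap_def by (subst integral_distr) (simp_all add: d T(2))
  finally show "frac_lap s f x = frac_lap s f y" by simp
qed

text \<open>Under the substitution \<open>c z\<close> the kernel contributes
  \<open>c powr (N + 2 s)\<close>, where N is the dimension, and the Jacobian
  \<open>c powr (- N)\<close>.\<close>

lemma frac_lap_scale:
  fixes f :: "'a::euclidean_space \<Rightarrow> real"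
  assumes f: "test_fun U f" and c: "c > 0"
  shows "frac_lap s (\<lambda>x. f (c *\<^sub>R x)) x = c powr (2 * s) * frac_lap s f (c *\<^sub>R x)"
proof -
  let ?p = "real DIM('a) + 2 * s"
  have [measurable]: "diff2 f (c *\<^sub>R x) \<in> borel_measurable borel"
    by (intro diff2_measurable test_fun_measurable[OF f])
  have "diff2 (\<lambda>x. f (c *\<^sub>R x)) x z / norm z powr ?p
      = c powr ?p * (diff2 f (c *\<^sub>R x) (c *\<^sub>R z) / norm (c *\<^sub>R z) powr ?p)" for z
    using c by (simp add: diff2_def scaleR_add_right scaleR_diff_right powr_mult)
  then have "frac_lap s (\<lambda>x. f (c *\<^sub>R x)) x
      = c powr ?p * (\<integral>z. diff2 f (c *\<^sub>R x) (c *\<^sub>R z) / norm (c *\<^sub>R z) powr ?p \<partial>lborel)"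
    by (simp only: frac_lap_def integral_mult_right_zero)
  also have "\<dots> = c powr ?p * (frac_lap s f (c *\<^sub>R x) / c ^ DIM('a))"
    unfolding frac_lap_def
    using integral_lborel_scale[OF c, of "\<lambda>z. diff2 f (c *\<^sub>R x) z / norm z powr ?p"] by simp
  also have "\<dots> = c powr (2 * s) * frac_lap s f (c *\<^sub>R x)"
    using c by (simp add: powr_add powr_realpow)
  finally show ?thesis .
qed

context
  fixes s :: real
  assumes s: "0 < s" "s < 1"
begin

lemma integrable_trunc_kernel: "integrable lborel (trunc_kernel s :: 'a::euclidean_space \<Rightarrow> real)"
  unfolding trunc_kernel_def[abs_def] using integrable_truncated_kernel[OF s] .

text \<open>The majorant is the natural size of a second difference. That the bound is linear in
  \<open>K\<close> matters: \<open>K\<close> will carry the factor \<open>h\<^sup>2\<close> of a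
  Taylor remainder.\<close>

lemma
  fixes h :: "'a::euclidean_space \<Rightarrow> real"
  assumes [measurable]: "h \<in> borel_measurable borel"
    and K: "\<And>z. \<bar>h z\<bar> \<le> K * min 1 ((norm z)\<^sup>2)"
  shows integrable_kernel: "integrable lborel (\<lambda>z. h z / norm z powr (real DIM('a) + 2 * s))"
    and integral_kernel_le: "\<bar>\<integral>z. h z / norm z powr (real DIM('a) + 2 * s) \<partial>lborel\<bar>
           \<le> K * (\<integral>z. trunc_kernel s (z::'a) \<partial>lborel)"
proof -
  have b: "\<bar>h z / norm z powr (real DIM('a) + 2 * s)\<bar> \<le> K * trunc_kernel s z" for z
    using divide_right_mono[OF K[of z], of "norm z powr (real DIM('a) + 2 * s)"]
    by (simp add: trunc_kernel_def abs_divide)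
  have i: "integrable lborel (\<lambda>z::'a. K * trunc_kernel s z)"
    by (intro integrable_mult_right integrable_trunc_kernel)
  show I: "integrable lborel (\<lambda>z. h z / norm z powr (real DIM('a) + 2 * s))"
  proof (rule Bochner_Integration.integrable_bound[OF i])
    show "AE x in lborel. norm (h x / norm x powr (real DIM('a) + 2 * s)) \<le> norm (K * trunc_kernel s x)"
      using b order_trans[OF b abs_ge_self] by (intro AE_I2) (simp add: real_norm_def)
  qed measurable
  have "\<bar>\<integral>z. h z / norm z powr (real DIM('a) + 2 * s) \<partial>lborel\<bar>
      \<le> (\<integral>z. \<bar>h z / norm z powr (real DIM('a) + 2 * s)\<bar> \<partial>lborel)"
    by (rule integral_abs_bound)
  also have "\<dots> \<le> (\<integral>z. K * trunc_kernel s (z::'a) \<partial>lborel)"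
    by (intro integral_mono i integrable_abs I b)
  finally show "\<bar>\<integral>z. h z / norm z powr (real DIM('a) + 2 * s) \<partial>lborel\<bar>
           \<le> K * (\<integral>z. trunc_kernel s (z::'a) \<partial>lborel)" by simp
qed

lemma integrable_frac_lap:
  fixes f :: "'a::euclidean_space \<Rightarrow> real"
  assumes f: "test_fun U f"
  shows "integrable lborel (\<lambda>z. diff2 f x z / norm z powr (real DIM('a) + 2 * s))"
proof -
  obtain K where "\<And>x z. \<bar>diff2 f x z\<bar> \<le> K * min 1 ((norm z)\<^sup>2)"
    using test_fun_diff2_bound[OF f] by blast
  then show ?thesis by (intro integrable_kernel diff2_measurable test_fun_measurable[OF f])
qed

lemma frac_lap_bounded:
  fixes f :: "'a::euclidean_space \<Rightarrow> real"
  assumes f: "test_fun U f"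
  obtains B where "B \<ge> 0" "\<And>x. \<bar>frac_lap s f x\<bar> \<le> B"
proof -
  obtain K where K: "K > 0" "\<And>x z. \<bar>diff2 f x z\<bar> \<le> K * min 1 ((norm z)\<^sup>2)"
    using test_fun_diff2_bound[OF f] by blast
  show ?thesis
  proof
    show "\<bar>frac_lap s f x\<bar> \<le> K * (\<integral>z. trunc_kernel s (z::'a) \<partial>lborel)" for x
      unfolding frac_lap_def by (intro integral_kernel_le diff2_measurable test_fun_measurable[OF f] K)
    show "0 \<le> K * (\<integral>z. trunc_kernel s (z::'a) \<partial>lborel)"
      using K(1) by (simp add: trunc_kernel_nonneg)
  qed
qed

lemma frac_lap_lincomb:
  fixes f g :: "'a::euclidean_space \<Rightarrow> real"
  assumes f: "test_fun UNIV f" and g: "test_fun UNIV g" and c: "c > 0" "d > 0"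
  shows "frac_lap s (\<lambda>x. a * f (c *\<^sub>R x) + b * g (d *\<^sub>R x)) x
    = a * c powr (2 * s) * frac_lap s f (c *\<^sub>R x) + b * d powr (2 * s) * frac_lap s g (d *\<^sub>R x)"
proof -
  let ?p = "real DIM('a) + 2 * s"
  let ?f = "\<lambda>x. f (c *\<^sub>R x)" and ?g = "\<lambda>x. g (d *\<^sub>R x)"
  have t: "test_fun UNIV ?f" "test_fun UNIV ?g"
    using test_fun_lincomb[OF f f c(1) c(1), of 1 0] test_fun_lincomb[OF g g c(2) c(2), of 1 0] by simp_all
  have "frac_lap s (\<lambda>x. a * ?f x + b * ?g x) x
      = (\<integral>z. a * (diff2 ?f x z / norm z powr ?p) + b * (diff2 ?g x z / norm z powr ?p) \<partial>lborel)"
    unfolding frac_lap_def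
    by (intro Bochner_Integration.integral_cong) (simp_all add: diff2_def add_divide_distrib diff_divide_distrib algebra_simps)
  also have "\<dots> = a * frac_lap s ?f x + b * frac_lap s ?g x"
    using integrable_frac_lap[OF t(1)] integrable_frac_lap[OF t(2)]
    by (simp only: frac_lap_def Bochner_Integration.integral_add integrable_mult_right integral_mult_right_zero)
  finally show ?thesis by (simp add: frac_lap_scale[OF f c(1)] frac_lap_scale[OF g c(2)])
qed

lemma DERIV_frac_lap:
  fixes f :: "'a::euclidean_space \<Rightarrow> real"
  assumes f: "test_fun UNIV f" and i: "i \<in> Basis"
  shows "((\<lambda>t. frac_lap s f (x + t *\<^sub>R i)) has_real_derivative frac_lap s (pd i f) (x + t *\<^sub>R i)) (at t)"
proof -
  define y where "y = x + t *\<^sub>R i"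
  have t1: "test_fun UNIV (pd i f)" and t2: "test_fun UNIV (pd i (pd i f))"
    using f i by (auto intro: test_fun_pd)
  obtain K where K: "K > 0" "\<And>x z. \<bar>diff2 (pd i (pd i f)) x z\<bar> \<le> K * min 1 ((norm z)\<^sup>2)"
    using test_fun_diff2_bound[OF t2] by blast
  define I where "I = (\<integral>z. trunc_kernel s (z::'a) \<partial>lborel)"
  \<comment> \<open>The remainder must be small in \<open>h\<close> and in \<open>z\<close> at once,
    since a bound by \<open>h\<^sup>2\<close> alone is not integrable against the kernel at
    \<open>z = 0\<close>. Expanding the second difference in \<open>h\<close> makes its second
    derivative a second difference of \<open>pd i (pd i f)\<close>, which brings its own factor
    \<open>min 1 ((norm z)\<^sup>2)\<close>.\<close>
  have rem: "\<bar>diff2 f (y + h *\<^sub>R i) z - diff2 f y z - h * diff2 (pd i f) y z\<bar> \<le> K * h\<^sup>2 * min 1 ((norm z)\<^sup>2)"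
    for h z
  proof -
    define diff where "diff m h = diff2 ((pd i ^^ m) f) (y + h *\<^sub>R i) z" for m h
    have d: "DERIV (diff m) h :> diff (Suc m) h" for m h
      unfolding diff_def using DERIV_diff2[OF test_fun_pd_funpow[OF f i] i] by simp
    obtain r where r: "diff 0 h = (\<Sum>m<2. diff m 0 / fact m * h ^ m) + diff 2 r / fact 2 * h ^ 2"
      using Maclaurin_all_le[of diff "diff 0" h 2] d by blast
    have "diff2 f (y + h *\<^sub>R i) z - diff2 f y z - h * diff2 (pd i f) y z = diff 2 r / 2 * h\<^sup>2"
      using r by (simp add: numeral_2_eq_2 diff_def)
    also have "\<bar>\<dots>\<bar> = \<bar>diff 2 r\<bar> * h\<^sup>2 / 2" by (simp add: abs_mult)
    also have "\<dots> \<le> \<bar>diff 2 r\<bar> * h\<^sup>2" by simp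
    also have "\<dots> \<le> K * min 1 ((norm z)\<^sup>2) * h\<^sup>2"
      using K(2) by (intro mult_right_mono) (auto simp: diff_def numeral_2_eq_2)
    finally show ?thesis by (simp add: mult_ac)
  qed
  have bound: "\<bar>frac_lap s f (y + h *\<^sub>R i) - frac_lap s f y - h * frac_lap s (pd i f) y\<bar> \<le> K * h\<^sup>2 * I" for h
  proof -
    let ?p = "real DIM('a) + 2 * s"
    have "frac_lap s f (y + h *\<^sub>R i) - frac_lap s f y - h * frac_lap s (pd i f) y
        = (\<integral>z. (diff2 f (y + h *\<^sub>R i) z - diff2 f y z - h * diff2 (pd i f) y z) / norm z powr ?p \<partial>lborel)"
      unfolding frac_lap_def
      by (simp add: diff_divide_distrib integrable_frac_lap[OF f] integrable_frac_lap[OF t1] flip: times_divide_eq_right)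
    also have "\<bar>\<dots>\<bar> \<le> K * h\<^sup>2 * I"
      unfolding I_def using diff2_measurable[OF test_fun_measurable[OF f]] diff2_measurable[OF test_fun_measurable[OF t1]]
      by (intro integral_kernel_le rem) simp_all
    finally show ?thesis .
  qed
  have "x + (t + h) *\<^sub>R i = y + h *\<^sub>R i" for h by (simp add: y_def algebra_simps)
  then show ?thesis
    using bound by (intro DERIV_quadratic_remainder[where C="K * I"]) (simp add: y_def[symmetric] mult_ac)
qed

end

section \<open>The weak formulation\<close>

lemma test_fun_continuous: "test_fun U f \<Longrightarrow> continuous_on UNIV f"
  by (intro smooth_fun_continuous) (simp add: test_fun_def)

lemma integrable_test_fun_mult:
  fixes \<phi> g :: "'a::euclidean_space \<Rightarrow> real"
  assumes \<phi>: "test_fun U \<phi>" and g: "continuous_on UNIV g"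
  shows "integrable lborel (\<lambda>x. \<phi> x * g x)"
proof -
  obtain R where R: "\<And>x. norm x > R \<Longrightarrow> \<phi> x = 0"
    using test_fun_zero_outside[OF \<phi>] by blast
  have "continuous_on UNIV \<phi>" using \<phi> by (rule test_fun_continuous)
  then have "continuous_on (cball 0 R) (\<lambda>x. \<phi> x * g x)"
    using g by (intro continuous_on_mult) (auto intro: continuous_on_subset)
  then have "integrable lborel (\<lambda>x. indicator (cball 0 R) x *\<^sub>R (\<phi> x * g x))"
    by (intro borel_integrable_compact) auto
  also have "(\<lambda>x. indicator (cball 0 R) x *\<^sub>R (\<phi> x * g x)) = (\<lambda>x. \<phi> x * g x)"
    using R by (auto simp: fun_eq_iff indicator_def not_le)
  finally show ?thesis .
qed

text \<open>Discrete integration by parts: the half containing \<open>\<phi> (x + z)\<close> is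
  translated by \<open>z\<close>, which moves the difference of \<open>f\<close> to the other side
  of \<open>x\<close>. The function \<open>b\<close> is that half after the translation, with
  reversed sign.\<close>

lemma integral_by_parts_diff:
  fixes f \<phi> :: "'a::euclidean_space \<Rightarrow> real"
  assumes f: "test_fun UNIV f" and \<phi>: "test_fun U \<phi>"
  shows "(\<integral>x. (f x - f (x + z)) * (\<phi> x - \<phi> (x + z)) \<partial>lborel) = (\<integral>x. \<phi> x * diff2 f x z \<partial>lborel)"
proof -
  have c: "continuous_on UNIV f" using f by (rule test_fun_continuous)
  have c': "continuous_on UNIV (\<lambda>x. f (x + z))" "continuous_on UNIV (\<lambda>x. f (x - z))"
    by (rule continuous_on_compose2[OF c]; auto intro!: continuous_intros)+
  define b where "b x = \<phi> x * (f (x - z) - f x)" for x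
  have ib: "integrable lborel b" and ia: "integrable lborel (\<lambda>x. \<phi> x * (f x - f (x + z)))"
    unfolding b_def[abs_def] by (intro integrable_test_fun_mult[OF \<phi>] continuous_on_diff c c')+
  have ib': "integrable lborel (\<lambda>x. b (z + x))" by (rule integrable_lborel_translation[OF ib])
  have "(\<integral>x. (f x - f (x + z)) * (\<phi> x - \<phi> (x + z)) \<partial>lborel)
      = (\<integral>x. \<phi> x * (f x - f (x + z)) - b (z + x) \<partial>lborel)"
    by (intro Bochner_Integration.integral_cong) (simp_all add: b_def algebra_simps)
  also have "\<dots> = (\<integral>x. \<phi> x * (f x - f (x + z)) \<partial>lborel) - (\<integral>x. b (z + x) \<partial>lborel)"
    by (rule Bochner_Integration.integral_diff[OF ia ib'])
  also have "(\<integral>x. b (z + x) \<partial>lborel) = (\<integral>x. b x \<partial>lborel)"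
    using ib by (intro integral_lborel_translation) auto
  also have "(\<integral>x. \<phi> x * (f x - f (x + z)) \<partial>lborel) - (\<integral>x. b x \<partial>lborel)
      = (\<integral>x. \<phi> x * (f x - f (x + z)) - b x \<partial>lborel)"
    by (rule Bochner_Integration.integral_diff[OF ia ib, symmetric])
  also have "\<dots> = (\<integral>x. \<phi> x * diff2 f x z \<partial>lborel)"
    by (intro Bochner_Integration.integral_cong) (simp_all add: b_def diff2_def algebra_simps)
  finally show ?thesis .
qed

lemma test_fun_diff_bound:
  fixes f :: "'a::euclidean_space \<Rightarrow> real"
  assumes f: "test_fun U f"
  obtains K where "K > 0" "\<And>x z. \<bar>f x - f (x + z)\<bar> \<le> K * min 1 (norm z)"
proof -
  obtain B where B: "B > 0" "\<And>x. \<bar>f x\<bar> \<le> B" using test_fun_bounded[OF f] by blast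
  obtain L where L: "L > 0" "\<And>x y. \<bar>f x - f y\<bar> \<le> L * norm (x - y)" using test_fun_lipschitz[OF f] by blast
  show ?thesis
  proof (rule that[of "2 * B + L"])
    fix x z
    have "\<bar>f x - f (x + z)\<bar> \<le> 2 * B" using B(2)[of x] B(2)[of "x + z"] by linarith
    moreover have "\<bar>f x - f (x + z)\<bar> \<le> L * norm z" using L(2)[of x "x + z"] by simp
    moreover have "L * norm z \<le> (2 * B + L) * norm z" using B by (intro mult_right_mono) auto
    ultimately show "\<bar>f x - f (x + z)\<bar> \<le> (2 * B + L) * min 1 (norm z)"
      using L(1) by (auto simp: min_def)
  qed (use B L in auto)
qed

context
  fixes s :: real
  assumes s: "0 < s" "s < 1"
begin

text \<open>Integrating in \<open>x\<close> first gives at most twice the volume of the ball,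
  whatever \<open>z\<close> is; what is left is the integrable \<open>trunc_kernel\<close>.\<close>

lemma integrable_pair_kernel:
  fixes J :: "'a::euclidean_space \<Rightarrow> 'a \<Rightarrow> real"
  assumes [measurable]: "case_prod J \<in> borel_measurable (lborel \<Otimes>\<^sub>M lborel)"
    and K: "K \<ge> 0"
    and b: "\<And>x z. \<bar>J x z\<bar> \<le> K * trunc_kernel s z * (indicator (cball 0 R) x + indicator (cball 0 R) (x + z))"
  shows "integrable (lborel \<Otimes>\<^sub>M lborel) (case_prod J)"
proof (rule integrableI_bounded)
  have [measurable]: "cball (0::'a) R \<in> sets borel" by (simp add: borel_closed)
  let ?i = "indicator (cball 0 R) :: 'a \<Rightarrow> ennreal"
  let ?E = "emeasure lborel (cball (0::'a) R)"
  have le: "ennreal \<bar>J x z\<bar> \<le> ennreal (K * trunc_kernel s z) * (?i x + ?i (z + x))" for x z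
  proof -
    have "ennreal \<bar>J x z\<bar> \<le> ennreal (K * trunc_kernel s z * (indicator (cball 0 R) x + indicator (cball 0 R) (x + z)))"
      by (intro ennreal_leI b)
    also have "\<dots> = ennreal (K * trunc_kernel s z) * (?i x + ?i (z + x))"
      using K by (simp add: ennreal_mult trunc_kernel_nonneg ennreal_indicator add.commute)
    finally show ?thesis .
  qed
  have fin: "?E < \<infinity>"
    using emeasure_lborel_cball_finite[of "0::'a" R] .
  have inner: "(\<integral>\<^sup>+x. ?i x + ?i (z + x) \<partial>lborel) = ?E + ?E" for z
    using nn_integral_lborel_translation[of ?i z] by (subst nn_integral_add) simp_all
  have "(\<integral>\<^sup>+p. ennreal (norm (case_prod J p)) \<partial>(lborel \<Otimes>\<^sub>M lborel)) = (\<integral>\<^sup>+z. (\<integral>\<^sup>+x. ennreal \<bar>J x z\<bar> \<partial>lborel) \<partial>lborel)"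
    by (subst lborel_pair.nn_integral_snd[symmetric]) simp_all
  also have "\<dots> \<le> (\<integral>\<^sup>+z. (\<integral>\<^sup>+x. ennreal (K * trunc_kernel s z) * (?i x + ?i (z + x)) \<partial>lborel) \<partial>lborel)"
    by (intro nn_integral_mono le)
  also have "\<dots> = (\<integral>\<^sup>+z. ennreal (K * trunc_kernel s (z::'a)) * (?E + ?E) \<partial>lborel)"
    by (subst nn_integral_cmult) (simp_all add: inner)
  also have "\<dots> = (\<integral>\<^sup>+z. ennreal (K * trunc_kernel s (z::'a)) \<partial>lborel) * (?E + ?E)"
    by (rule nn_integral_multc) measurable
  also have "\<dots> < \<infinity>"
  proof -
    have "integrable lborel (\<lambda>z::'a. K * trunc_kernel s z)"
      using s by (intro integrable_mult_right integrable_trunc_kernel)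
    then have "(\<integral>\<^sup>+z. ennreal (K * trunc_kernel s (z::'a)) \<partial>lborel) < \<infinity>"
      using K unfolding integrable_iff_bounded by (simp add: trunc_kernel_nonneg abs_mult del: integrable_mult_right_iff)
    then show ?thesis using fin by (simp add: ennreal_mult_less_top)
  qed
  finally show "(\<integral>\<^sup>+p. ennreal (norm (case_prod J p)) \<partial>(lborel \<Otimes>\<^sub>M lborel)) < \<infinity>" .
qed measurable

text \<open>For \<open>s \<ge> 1/2\<close> a single difference of \<open>f\<close> need not be
  integrable against the kernel, so the form cannot be split into its two halves directly. After the
  substitution \<open>y = x + z\<close> the order of integration is exchanged, the splitting is done
  for fixed \<open>z\<close> where no singularity is seen, and the order is exchanged back once a
  second difference has formed. Both exchanges need absolute convergence: of \<open>J\<close> before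
  and of \<open>H\<close> after.\<close>

lemma gagliardo_form_eq:
  fixes f \<phi> :: "'a::euclidean_space \<Rightarrow> real"
  assumes f: "test_fun UNIV f" and \<phi>: "test_fun U \<phi>"
  shows "(\<integral>p. (f (fst p) - f (snd p)) * (\<phi> (fst p) - \<phi> (snd p)) /
             norm (fst p - snd p) powr (real DIM('a) + 2 * s) \<partial>(lborel \<Otimes>\<^sub>M lborel))
         = (\<integral>x. frac_lap s f x * \<phi> x \<partial>lborel)"
proof -
  let ?p = "real DIM('a) + 2 * s"
  have [measurable]: "f \<in> borel_measurable borel" "\<phi> \<in> borel_measurable borel"
    using test_fun_measurable[OF f] test_fun_measurable[OF \<phi>] .
  obtain R where R: "\<And>x. norm x > R \<Longrightarrow> \<phi> x = 0" using test_fun_zero_outside[OF \<phi>] by blast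
  obtain Kf where Kf: "Kf > 0" "\<And>x z. \<bar>f x - f (x + z)\<bar> \<le> Kf * min 1 (norm z)"
    using test_fun_diff_bound[OF f] by blast
  obtain Kp where Kp: "Kp > 0" "\<And>x z. \<bar>\<phi> x - \<phi> (x + z)\<bar> \<le> Kp * min 1 (norm z)"
    using test_fun_diff_bound[OF \<phi>] by blast
  obtain K2 where K2: "K2 > 0" "\<And>x z. \<bar>diff2 f x z\<bar> \<le> K2 * min 1 ((norm z)\<^sup>2)"
    using test_fun_diff2_bound[OF f] by blast
  obtain B where B: "B > 0" "\<And>x. \<bar>\<phi> x\<bar> \<le> B" using test_fun_bounded[OF \<phi>] by blast
  let ?i = "indicator (cball 0 R) :: 'a \<Rightarrow> real"
  \<comment> \<open>Each of the two first differences in \<open>J\<close> supplies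
    \<open>min 1 (norm z)\<close>; their product is exactly the numerator of
    \<open>trunc_kernel\<close>.\<close>
  have msq: "min 1 r * min 1 r = min 1 (r\<^sup>2)" if "r \<ge> 0" for r :: real
    using that power_mono[of r 1 2] power_mono[of 1 r 2] by (auto simp: min_def power2_eq_square)
  define J where "J x z = (f x - f (x + z)) * (\<phi> x - \<phi> (x + z)) / norm z powr ?p" for x z
  define H where "H x z = \<phi> x * diff2 f x z / norm z powr ?p" for x z
  have [measurable]: "case_prod J \<in> borel_measurable (lborel \<Otimes>\<^sub>M lborel)"
    unfolding J_def[abs_def] by measurable
  have [measurable]: "case_prod H \<in> borel_measurable (lborel \<Otimes>\<^sub>M lborel)"
    unfolding H_def[abs_def] diff2_def by measurable
  have iJ: "integrable (lborel \<Otimes>\<^sub>M lborel) (case_prod J)"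
  proof (rule integrable_pair_kernel)
    show "0 \<le> Kf * Kp" using Kf Kp by simp
    fix x z
    have 1: "\<bar>\<phi> x - \<phi> (x + z)\<bar> \<le> Kp * min 1 (norm z) * (?i x + ?i (x + z))"
    proof (cases "norm x > R \<and> norm (x + z) > R")
      case False
      have "\<bar>\<phi> x - \<phi> (x + z)\<bar> \<le> Kp * min 1 (norm z) * 1" using Kp(2) by simp
      also have "\<dots> \<le> Kp * min 1 (norm z) * (?i x + ?i (x + z))"
        using False Kp(1) by (intro mult_left_mono) (auto simp: indicator_def)
      finally show ?thesis .
    qed (use R in \<open>simp add: Kp less_imp_le\<close>)
    have "\<bar>f x - f (x + z)\<bar> * \<bar>\<phi> x - \<phi> (x + z)\<bar>
        \<le> (Kf * min 1 (norm z)) * (Kp * min 1 (norm z) * (?i x + ?i (x + z)))"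
      using Kf Kp by (intro mult_mono 1 Kf) auto
    also have "\<dots> = Kf * Kp * (min 1 (norm z) * min 1 (norm z)) * (?i x + ?i (x + z))"
      by (simp only: mult_ac)
    also have "\<dots> = Kf * Kp * min 1 ((norm z)\<^sup>2) * (?i x + ?i (x + z))"
      by (simp only: msq[OF norm_ge_zero])
    finally have "\<bar>f x - f (x + z)\<bar> * \<bar>\<phi> x - \<phi> (x + z)\<bar> / norm z powr ?p
       \<le> Kf * Kp * min 1 ((norm z)\<^sup>2) * (?i x + ?i (x + z)) / norm z powr ?p"
      by (intro divide_right_mono) auto
    then show "\<bar>J x z\<bar> \<le> Kf * Kp * trunc_kernel s z * (?i x + ?i (x + z))"
      by (simp add: J_def abs_mult trunc_kernel_def)
  qed measurable
  have iH: "integrable (lborel \<Otimes>\<^sub>M lborel) (case_prod H)"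
  proof (rule integrable_pair_kernel)
    show "0 \<le> B * K2" using B K2 by simp
    fix x z
    have 1: "\<bar>\<phi> x\<bar> \<le> B * (?i x + ?i (x + z))"
    proof (cases "norm x > R")
      case False
      have "\<bar>\<phi> x\<bar> \<le> B * 1" using B(2) by simp
      also have "\<dots> \<le> B * (?i x + ?i (x + z))"
        using False B(1) by (intro mult_left_mono) (auto simp: indicator_def)
      finally show ?thesis .
    qed (use R B in \<open>simp add: indicator_def\<close>)
    have "\<bar>\<phi> x\<bar> * \<bar>diff2 f x z\<bar> \<le> (B * (?i x + ?i (x + z))) * (K2 * min 1 ((norm z)\<^sup>2))"
      using B K2 by (intro mult_mono 1 K2) auto
    also have "\<dots> = B * K2 * min 1 ((norm z)\<^sup>2) * (?i x + ?i (x + z))" by (simp only: mult_ac)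
    finally have "\<bar>\<phi> x\<bar> * \<bar>diff2 f x z\<bar> / norm z powr ?p
       \<le> B * K2 * min 1 ((norm z)\<^sup>2) * (?i x + ?i (x + z)) / norm z powr ?p"
      by (intro divide_right_mono) auto
    then show "\<bar>H x z\<bar> \<le> B * K2 * trunc_kernel s z * (?i x + ?i (x + z))"
      by (simp add: H_def abs_mult trunc_kernel_def)
  qed measurable
  define G where "G p = (f (fst p) - f (snd p)) * (\<phi> (fst p) - \<phi> (snd p)) / norm (fst p - snd p) powr ?p" for p
  have mG[measurable]: "G \<in> borel_measurable (lborel \<Otimes>\<^sub>M lborel)"
    unfolding G_def[abs_def] by measurable
  have GJ: "G (x, x + z) = J x z" for x z by (simp add: G_def J_def)
  have mGx[measurable]: "(\<lambda>y. G (x, y)) \<in> borel_measurable borel" for x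
    unfolding G_def by simp
  \<comment> \<open>Integrability passes from \<open>J\<close> to \<open>G\<close> by Tonelli for
    the absolute values, since the shear \<open>y = x + z\<close> is a translation for each fixed
    \<open>x\<close>.\<close>
  have iG: "integrable (lborel \<Otimes>\<^sub>M lborel) G"
  proof (rule integrableI_bounded[OF mG])
    have "(\<integral>\<^sup>+p. ennreal (norm (G p)) \<partial>(lborel \<Otimes>\<^sub>M lborel))
        = (\<integral>\<^sup>+x. (\<integral>\<^sup>+y. ennreal (norm (G (x, y))) \<partial>lborel) \<partial>lborel)"
      by (subst lborel.nn_integral_fst[symmetric]) simp_all
    also have "\<dots> = (\<integral>\<^sup>+x. (\<integral>\<^sup>+z. ennreal (norm (G (x, x + z))) \<partial>lborel) \<partial>lborel)"
      using nn_integral_lborel_translation[of "\<lambda>y. ennreal (norm (G (x, y)))" x for x] by simp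
    also have "\<dots> = (\<integral>\<^sup>+p. ennreal (norm (case_prod J p)) \<partial>(lborel \<Otimes>\<^sub>M lborel))"
      unfolding GJ by (subst lborel.nn_integral_fst[symmetric]) simp_all
    also have "\<dots> < \<infinity>" using iJ by (simp add: integrable_iff_bounded)
    finally show "(\<integral>\<^sup>+p. ennreal (norm (G p)) \<partial>(lborel \<Otimes>\<^sub>M lborel)) < \<infinity>" .
  qed
  have "(\<integral>p. G p \<partial>(lborel \<Otimes>\<^sub>M lborel)) = (\<integral>x. (\<integral>y. G (x, y) \<partial>lborel) \<partial>lborel)"
    by (rule lborel_pair.integral_fst'[OF iG, symmetric])
  also have "\<dots> = (\<integral>x. (\<integral>z. J x z \<partial>lborel) \<partial>lborel)"
    unfolding GJ[symmetric] using integral_lborel_translation[OF mGx] by simp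
  also have "\<dots> = (\<integral>z. (\<integral>x. J x z \<partial>lborel) \<partial>lborel)"
    by (rule lborel_pair.Fubini_integral[OF iJ, symmetric])
  also have "\<dots> = (\<integral>z. (\<integral>x. H x z \<partial>lborel) \<partial>lborel)"
    unfolding J_def H_def using integral_by_parts_diff[OF f \<phi>] by simp
  also have "\<dots> = (\<integral>x. (\<integral>z. H x z \<partial>lborel) \<partial>lborel)"
    by (rule lborel_pair.Fubini_integral[OF iH])
  also have "\<dots> = (\<integral>x. frac_lap s f x * \<phi> x \<partial>lborel)"
    unfolding H_def frac_lap_def by (simp add: mult.commute flip: times_divide_eq_right)
  finally show ?thesis unfolding G_def .
qed

end

section \<open>A flat bump function\<close>

text \<open>Differentiating \<open>exp (- c / t)\<close> creates powers of \<open>1 / t\<close>; the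
  index \<open>j\<close> makes the family closed under differentiation up to linear
  combinations.\<close>

definition flat :: "real \<Rightarrow> nat \<Rightarrow> real \<Rightarrow> real" where
  "flat c j t = (if t \<le> 0 then 0 else exp (- c / t) / t ^ j)"

lemma exp_ge_partial_sum:
  fixes x :: real
  assumes "x \<ge> 0"
  shows "(\<Sum>k<n. x ^ k / fact k) \<le> exp x"
proof -
  have "(\<lambda>k. x ^ k / fact k) sums exp x"
    using exp_converges[of x] by (simp add: divide_inverse mult.commute)
  then show ?thesis
    using sum_le_suminf[of "\<lambda>k. x ^ k / fact k" "{..<n}"] assms
    by (auto simp: sums_iff)
qed

text \<open>The exponential \<open>exp (c / t)\<close> dominates the term of degree
  \<open>j + 2\<close> of its series. Dividing by \<open>t ^ j\<close> uses up \<open>j\<close> of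
  these powers, and the two left over give differentiability at 0 with derivative 0.\<close>

lemma flat_quadratic_bound:
  assumes c: "c > 0"
  shows "\<bar>flat c j t\<bar> \<le> fact (j + 2) / c ^ (j + 2) * t\<^sup>2"
proof (cases "t \<le> 0")
  case False
  then have t: "t > 0" by simp
  define n F where "n = j + 2" and "F = (fact n :: real)"
  have "(c / t) ^ n / F \<le> (\<Sum>k<n + 1. (c / t) ^ k / fact k)"
    using c t unfolding F_def by (intro member_le_sum) auto
  also have "\<dots> \<le> exp (c / t)" using c t by (intro exp_ge_partial_sum) simp
  finally have "inverse (exp (c / t)) \<le> inverse ((c / t) ^ n / F)"
    using c t by (intro le_imp_inverse_le) (auto simp: F_def)
  also have "\<dots> = F / c ^ n * t\<^sup>2 * t ^ j"
    using c t by (simp add: power_divide n_def power_add mult_ac power2_eq_square)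
  finally have "exp (- c / t) / t ^ j \<le> F / c ^ n * t\<^sup>2"
    using t by (simp add: exp_minus divide_le_eq)
  then show ?thesis using t by (simp add: flat_def n_def F_def del: fact_Suc)
qed (use c in \<open>simp add: flat_def\<close>)

lemma DERIV_flat:
  assumes c: "c > 0"
  shows "(flat c j has_real_derivative c * flat c (j + 2) t - real j * flat c (j + 1) t) (at t)"
proof -
  consider "t < 0" | "t = 0" | "t > 0" by linarith
  then show ?thesis
  proof cases
    case 1
    have "((\<lambda>_. 0) has_real_derivative 0) (at t)" by simp
    then have "(flat c j has_real_derivative 0) (at t)"
      by (rule has_field_derivative_transform_within_open[where S="{..<0}"]) (use 1 in \<open>auto simp: flat_def\<close>)
    then show ?thesis using 1 by (simp add: flat_def)
  next
    case 2
    have f0: "flat c j 0 = 0" by (simp add: flat_def)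
    have "(flat c j has_real_derivative 0) (at 0)"
      using flat_quadratic_bound[OF c, of j]
      by (intro DERIV_quadratic_remainder[where C="fact (j + 2) / c ^ (j + 2)"])
        (simp only: f0 add_0 diff_0_right mult_zero_right)
    then show ?thesis using 2 by (simp add: flat_def)
  next
    case 3
    have "((\<lambda>t. exp (- c / t) / t ^ j) has_real_derivative
       (exp (- c / t) * (c / t\<^sup>2) * t ^ j - exp (- c / t) * (real j * t ^ (j - 1))) / (t ^ j * t ^ j)) (at t)"
      using 3 by (auto intro!: derivative_eq_intros simp: power2_eq_square)
    also have "(exp (- c / t) * (c / t\<^sup>2) * t ^ j - exp (- c / t) * (real j * t ^ (j - 1))) / (t ^ j * t ^ j)
       = c * flat c (j + 2) t - real j * flat c (j + 1) t"
      using 3 by (cases j) (auto simp: flat_def field_simps power2_eq_square)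
    finally show ?thesis
      by (rule has_field_derivative_transform_within_open[where S="{0<..}"]) (use 3 in \<open>auto simp: flat_def\<close>)
  qed
qed

text \<open>An algebra of functions whose partial derivatives stay inside it. Smoothness of every
  member then follows by induction on the order, without any formula for higher derivatives.\<close>

inductive_set flat_alg :: "real \<Rightarrow> ('a::euclidean_space \<Rightarrow> real) set" for c :: real where
  const: "(\<lambda>x. a) \<in> flat_alg c"
| coord: "i \<in> Basis \<Longrightarrow> (\<lambda>x. x \<bullet> i) \<in> flat_alg c"
| flat: "(\<lambda>x. flat c j (1 - x \<bullet> x)) \<in> flat_alg c"
| add: "f \<in> flat_alg c \<Longrightarrow> g \<in> flat_alg c \<Longrightarrow> (\<lambda>x. f x + g x) \<in> flat_alg c"
| mult: "f \<in> flat_alg c \<Longrightarrow> g \<in> flat_alg c \<Longrightarrow> (\<lambda>x. f x * g x) \<in> flat_alg c"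

lemma flat_alg_sum:
  "finite I \<Longrightarrow> (\<And>i. i \<in> I \<Longrightarrow> f i \<in> flat_alg c) \<Longrightarrow> (\<lambda>x. \<Sum>i\<in>I. f i x) \<in> flat_alg c"
  by (induction I rule: finite_induct) (auto intro: flat_alg.intros)

lemma flat_alg_sq_norm: "(\<lambda>x::'a::euclidean_space. x \<bullet> x) \<in> flat_alg c"
proof -
  have "(\<lambda>x::'a. \<Sum>i\<in>Basis. (x \<bullet> i) * (x \<bullet> i)) \<in> flat_alg c"
    by (rule flat_alg_sum) (auto intro: flat_alg.mult flat_alg.coord)
  also have "(\<lambda>x::'a. \<Sum>i\<in>Basis. (x \<bullet> i) * (x \<bullet> i)) = (\<lambda>x. x \<bullet> x)"
    by (rule ext, rule euclidean_inner[symmetric])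
  finally show ?thesis .
qed

lemma flat_alg_derivative:
  fixes f :: "'a::euclidean_space \<Rightarrow> real"
  assumes c: "c > 0"
  shows "f \<in> flat_alg c \<Longrightarrow> \<exists>g. (\<forall>i\<in>Basis. g i \<in> flat_alg c) \<and>
     (\<forall>x. (f has_derivative (\<lambda>h. \<Sum>i\<in>Basis. (h \<bullet> i) * g i x)) (at x))"
proof (induction rule: flat_alg.induct)
  case (const a)
  show ?case by (rule exI[of _ "\<lambda>_ _. 0"]) (simp add: flat_alg.const)
next
  case (coord i)
  have "(\<Sum>j\<in>Basis. (h \<bullet> j) * (if j = i then 1 else 0)) = h \<bullet> i" for h :: 'a
    using coord by (simp add: if_distrib[of "\<lambda>a. _ * a"] cong: if_cong)
  then show ?case
    by (intro exI[of _ "\<lambda>j _. if j = i then 1 else 0"])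
       (auto simp: flat_alg.const intro!: derivative_eq_intros)
next
  case (flat j)
  let ?D = "\<lambda>t. c * flat c (j + 2) t - real j * flat c (j + 1) t"
  let ?g = "\<lambda>i x. (- 2 * (x \<bullet> i)) * (c * flat c (j + 2) (1 - x \<bullet> x) + (- real j) * flat c (j + 1) (1 - x \<bullet> x))"
  have "((\<lambda>x. flat c j (1 - x \<bullet> x)) has_derivative (\<lambda>h. \<Sum>i\<in>Basis. (h \<bullet> i) * ?g i x)) (at x)" for x :: 'a
  proof -
    have "((\<lambda>x. 1 - x \<bullet> x) has_derivative (\<lambda>h. - 2 * (x \<bullet> h))) (at x)"
      by (auto intro!: derivative_eq_intros simp: inner_commute)
    then have "((\<lambda>x. flat c j (1 - x \<bullet> x)) has_derivative (\<lambda>h. ?D (1 - x \<bullet> x) * (- 2 * (x \<bullet> h)))) (at x)"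
      using has_derivative_compose DERIV_flat[OF c, of j "1 - x \<bullet> x", unfolded has_field_derivative_def] by blast
    moreover have "?D (1 - x \<bullet> x) * (- 2 * (x \<bullet> h)) = (\<Sum>i\<in>Basis. (h \<bullet> i) * ?g i x)" for h
    proof -
      have "(\<Sum>i\<in>Basis. (h \<bullet> i) * ?g i x) = (\<Sum>i\<in>Basis. ?D (1 - x \<bullet> x) * - 2 * ((x \<bullet> i) * (h \<bullet> i)))"
        by (rule sum.cong) (simp_all add: algebra_simps)
      also have "\<dots> = ?D (1 - x \<bullet> x) * - 2 * (x \<bullet> h)"
        unfolding sum_distrib_left[symmetric] euclidean_inner[of x h, symmetric] ..
      finally show ?thesis by (simp only: mult.assoc)
    qed
    ultimately show ?thesis by simp
  qed
  moreover have "?g i \<in> flat_alg c" if "i \<in> Basis" for i :: 'a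
    using that by (intro flat_alg.intros)
  ultimately show ?case by (intro exI[of _ ?g]) blast
next
  case (add f1 f2)
  then obtain g1 g2 where g: "\<And>i. i \<in> Basis \<Longrightarrow> g1 i \<in> flat_alg c" "\<And>i. i \<in> Basis \<Longrightarrow> g2 i \<in> flat_alg c"
    "\<And>x. (f1 has_derivative (\<lambda>h. \<Sum>i\<in>Basis. (h \<bullet> i) * g1 i x)) (at x)"
    "\<And>x. (f2 has_derivative (\<lambda>h. \<Sum>i\<in>Basis. (h \<bullet> i) * g2 i x)) (at x)"
    by blast
  have "((\<lambda>x. f1 x + f2 x) has_derivative (\<lambda>h. \<Sum>i\<in>Basis. (h \<bullet> i) * (g1 i x + g2 i x))) (at x)" for x
    using has_derivative_add[OF g(3,4)] by (simp add: distrib_left sum.distrib)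
  then show ?case using g(1,2)
    by (intro exI[of _ "\<lambda>i x. g1 i x + g2 i x"]) (auto intro: flat_alg.add)
next
  case (mult f1 f2)
  then obtain g1 g2 where g: "\<And>i. i \<in> Basis \<Longrightarrow> g1 i \<in> flat_alg c" "\<And>i. i \<in> Basis \<Longrightarrow> g2 i \<in> flat_alg c"
    "\<And>x. (f1 has_derivative (\<lambda>h. \<Sum>i\<in>Basis. (h \<bullet> i) * g1 i x)) (at x)"
    "\<And>x. (f2 has_derivative (\<lambda>h. \<Sum>i\<in>Basis. (h \<bullet> i) * g2 i x)) (at x)"
    by blast
  have "((\<lambda>x. f1 x * f2 x) has_derivative (\<lambda>h. \<Sum>i\<in>Basis. (h \<bullet> i) * (f1 x * g2 i x + g1 i x * f2 x))) (at x)" for x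
    by (rule has_derivative_eq_rhs[OF has_derivative_mult[OF g(3,4)]])
       (simp add: fun_eq_iff sum_distrib_left sum_distrib_right sum.distrib[symmetric] algebra_simps)
  then show ?case using g(1,2) mult.hyps
    by (intro exI[of _ "\<lambda>i x. f1 x * g2 i x + g1 i x * f2 x"]) (auto intro!: flat_alg.add flat_alg.mult)
qed

lemma smooth_fun_flat_alg:
  fixes f :: "'a::euclidean_space \<Rightarrow> real"
  assumes c: "c > 0" and f: "f \<in> flat_alg c"
  shows "smooth_fun f"
proof -
  have "Ck_fun k f" for k using f
  proof (induction k arbitrary: f)
    case 0
    then obtain g where "\<And>x. (f has_derivative (\<lambda>h. \<Sum>i\<in>Basis. (h \<bullet> i) * g i x)) (at x)"
      using flat_alg_derivative[OF c, of f] by blast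
    then show ?case
      unfolding Ck_fun.simps by (intro continuous_at_imp_continuous_on ballI) (rule has_derivative_continuous)
  next
    case (Suc k)
    then obtain g where g: "\<And>i. i \<in> Basis \<Longrightarrow> g i \<in> flat_alg c"
        "\<And>x. (f has_derivative (\<lambda>h. \<Sum>i\<in>Basis. (h \<bullet> i) * g i x)) (at x)"
      using flat_alg_derivative[OF c, of f] by blast
    have "f differentiable_on UNIV"
      unfolding differentiable_on_def differentiable_def using g(2) by blast
    moreover have "pd i f = g i" if "i \<in> Basis" for i
      by (rule ext, rule pd_eqI[where g=g, OF g(2) that])
    ultimately show ?case unfolding Ck_fun_Suc_pd
      using Suc.IH g(1) by simp
  qed
  then show ?thesis by (simp add: smooth_fun_def)
qed

definition bump :: "real \<Rightarrow> 'a::euclidean_space \<Rightarrow> real" where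
  "bump c x = flat c 0 (1 - x \<bullet> x)"

definition quad_bump :: "real \<Rightarrow> 'a::euclidean_space \<Rightarrow> real" where
  "quad_bump c x = (x \<bullet> x) * bump c x"

lemma bump_zero: "norm x \<ge> 1 \<Longrightarrow> bump c x = 0"
  by (simp add: bump_def flat_def dot_square_norm)

lemma test_fun_bump: "c > 0 \<Longrightarrow> test_fun UNIV (bump c)"
  unfolding bump_def[abs_def]
  by (rule test_funI[where R=1], rule smooth_fun_flat_alg, assumption, rule flat_alg.flat)
     (simp add: bump_zero[unfolded bump_def])

lemma test_fun_quad_bump: "c > 0 \<Longrightarrow> test_fun UNIV (quad_bump c)"
  unfolding quad_bump_def[abs_def] bump_def[abs_def]
  by (rule test_funI[where R=1], rule smooth_fun_flat_alg, assumption,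
      intro flat_alg.mult flat_alg_sq_norm flat_alg.flat)
     (simp add: bump_zero[unfolded bump_def])

lemma pd_line_eqI:
  assumes "test_fun UNIV f" "i \<in> Basis"
    and "((\<lambda>t. f (x + t *\<^sub>R i)) has_real_derivative D) (at 0)"
  shows "pd i f x = D"
  using DERIV_unique[OF test_fun_DERIV_pd[OF assms(1,2), of x 0] assms(3)] by simp

lemma pd_quad_bump:
  assumes c: "c > 0" and i: "i \<in> Basis"
  shows "pd i (quad_bump c) x
    = 2 * (x \<bullet> i) * (flat c 0 (1 - x \<bullet> x) - c * (x \<bullet> x) * flat c 2 (1 - x \<bullet> x))"
    and "pd i (pd i (quad_bump c)) x
    = 2 * (flat c 0 (1 - x \<bullet> x) - c * (x \<bullet> x) * flat c 2 (1 - x \<bullet> x))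
      + 4 * (x \<bullet> i)\<^sup>2 * (- 2 * c * flat c 2 (1 - x \<bullet> x)
          + c * (x \<bullet> x) * (c * flat c 4 (1 - x \<bullet> x) - 2 * flat c 3 (1 - x \<bullet> x)))"
proof -
  have ii: "i \<bullet> i = 1" using i by simp
  have tau: "((\<lambda>t. (x + t *\<^sub>R i) \<bullet> (x + t *\<^sub>R i)) has_real_derivative 2 * (x \<bullet> i)) (at 0)" for x
    by (simp add: inner_add_left inner_add_right ii inner_commute[of i x])
      (auto intro!: derivative_eq_intros)
  have fl: "((\<lambda>t. flat c j (1 - (x + t *\<^sub>R i) \<bullet> (x + t *\<^sub>R i))) has_real_derivative
     (c * flat c (j + 2) (1 - x \<bullet> x) - real j * flat c (j + 1) (1 - x \<bullet> x)) * (- 2 * (x \<bullet> i))) (at 0)" for x j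
  proof -
    have "((\<lambda>t. 1 - (x + t *\<^sub>R i) \<bullet> (x + t *\<^sub>R i)) has_real_derivative - 2 * (x \<bullet> i)) (at 0)"
      using DERIV_diff[OF DERIV_const tau[of x], of 1] by simp
    from DERIV_chain2[OF _ this, of "flat c j"] DERIV_flat[OF c, of j "1 - x \<bullet> x"]
    show ?thesis by simp
  qed
  have fl0: "((\<lambda>t. flat c 0 (1 - (x + t *\<^sub>R i) \<bullet> (x + t *\<^sub>R i))) has_real_derivative
     - 2 * (x \<bullet> i) * (c * flat c 2 (1 - x \<bullet> x))) (at 0)" for x
    by (rule DERIV_cong[OF fl]) (simp add: numeral_2_eq_2)
  have fl2: "((\<lambda>t. flat c 2 (1 - (x + t *\<^sub>R i) \<bullet> (x + t *\<^sub>R i))) has_real_derivative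
     - 2 * (x \<bullet> i) * (c * flat c 4 (1 - x \<bullet> x) - 2 * flat c 3 (1 - x \<bullet> x))) (at 0)" for x
    by (rule DERIV_cong[OF fl]) simp
  have co: "((\<lambda>t. (x + t *\<^sub>R i) \<bullet> i) has_real_derivative 1) (at 0)" for x
    by (simp add: inner_add_left ii) (auto intro!: derivative_eq_intros)
  show 1: "pd i (quad_bump c) x
    = 2 * (x \<bullet> i) * (flat c 0 (1 - x \<bullet> x) - c * (x \<bullet> x) * flat c 2 (1 - x \<bullet> x))" for x
    by (rule pd_line_eqI[OF test_fun_quad_bump[OF c] i], unfold quad_bump_def bump_def,
        rule DERIV_cong[OF DERIV_mult[OF tau fl0]]) (simp add: algebra_simps)
  have t: "test_fun UNIV (pd i (quad_bump c))" by (rule test_fun_pd[OF test_fun_quad_bump[OF c] i])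
  show "pd i (pd i (quad_bump c)) x
    = 2 * (flat c 0 (1 - x \<bullet> x) - c * (x \<bullet> x) * flat c 2 (1 - x \<bullet> x))
      + 4 * (x \<bullet> i)\<^sup>2 * (- 2 * c * flat c 2 (1 - x \<bullet> x)
          + c * (x \<bullet> x) * (c * flat c 4 (1 - x \<bullet> x) - 2 * flat c 3 (1 - x \<bullet> x)))"
    by (rule pd_line_eqI[OF t i], unfold 1,
        rule DERIV_cong[OF DERIV_mult[OF DERIV_cmult[OF co] DERIV_diff[OF fl0 DERIV_mult[OF DERIV_cmult[OF tau] fl2]]]])
       (simp add: algebra_simps power2_eq_square)
qed

text \<open>Here \<open>m\<close> equals \<open>\<sigma> * (1 + \<sigma> / 100)\<close>, where the
  quadratic correction comes from the factor \<open>1 / (1 - |x|^2)\<close> in the bump. The Taylor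
  polynomial of degree four already suffices: it dominates the fourth-order term
  \<open>2 * \<sigma>^4 / 10000\<close> of the left side.\<close>

lemma exp_ge_quadratic:
  fixes \<sigma> :: real
  assumes s: "\<sigma> \<ge> 0"
  defines "m \<equiv> \<sigma> + \<sigma>\<^sup>2 / 100"
  shows "1 - 5 * m + 2 * m\<^sup>2 \<le> exp \<sigma>"
proof -
  have "1 + \<sigma> + \<sigma>^2 / 2 + \<sigma>^3 / 6 + \<sigma>^4 / 24 \<le> exp \<sigma>"
    using exp_ge_partial_sum[OF s, of 5] by (simp add: eval_nat_numeral)
  moreover have "1 + \<sigma> + \<sigma>^2 / 2 + \<sigma>^3 / 6 + \<sigma>^4 / 24 - (1 - 5 * m + 2 * m\<^sup>2)
     = \<sigma> * ((6 - 29/20 * \<sigma> + 19/150 * \<sigma>^2) + (1/24 - 1/5000) * \<sigma>^3)"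
    unfolding m_def by (simp add: field_simps power2_eq_square power3_eq_cube power4_eq_xxxx)
  moreover have "6 - 29/20 * \<sigma> + 19/150 * \<sigma>^2 \<ge> 0"
  proof -
    \<comment> \<open>Completing the square at the vertex \<open>435/76\<close>; the quadratic has
      negative discriminant, so the constant left over is positive.\<close>
    have "6 - 29/20 * \<sigma> + 19/150 * \<sigma>^2 = 19/150 * (\<sigma> - 435/76)^2 + (6 - 19/150 * (435/76)^2)"
      by (simp add: power2_eq_square field_simps)
    then show ?thesis by (simp add: power2_eq_square)
  qed
  moreover have "(1/24 - 1/5000) * \<sigma>^3 \<ge> 0" using s by simp
  ultimately show ?thesis using mult_nonneg_nonneg[OF s, of "(6 - 29/20 * \<sigma> + 19/150 * \<sigma>^2) + (1/24 - 1/5000) * \<sigma>^3"] by linarith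
qed

section \<open>Behaviour of the fractional Laplacian at the origin\<close>

text \<open>The second derivative is affine in \<open>(x \<bullet> i)\<^sup>2 \<in> [0, |x|\<^sup>2]\<close>, so it suffices to bound it at the
  two endpoints. With \<open>\<sigma> = c |x|\<^sup>2 / (1 - |x|\<^sup>2)\<close> the endpoint \<open>|x|\<^sup>2\<close> reduces to
  the preceding estimate of the exponential; this is where \<open>c\<close> has to be large.\<close>

lemma pd_pd_quad_bump_le:
  assumes i: "i \<in> Basis"
  shows "pd i (pd i (quad_bump 100)) x \<le> pd i (pd i (quad_bump 100)) 0"
proof -
  define \<tau> where "\<tau> = x \<bullet> x"
  define X where "X = (x \<bullet> i)\<^sup>2"
  have \<tau>0: "\<tau> \<ge> 0" by (simp add: \<tau>_def)
  have X: "0 \<le> X" "X \<le> \<tau>"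
    using Cauchy_Schwarz_ineq[of x i] i by (auto simp: X_def \<tau>_def inner_Basis)
  define A where "A = flat 100 0 (1 - \<tau>) - 100 * \<tau> * flat 100 2 (1 - \<tau>)"
  define Z where "Z = - 2 * 100 * flat 100 2 (1 - \<tau>)
     + 100 * \<tau> * (100 * flat 100 4 (1 - \<tau>) - 2 * flat 100 3 (1 - \<tau>))"
  have val: "pd i (pd i (quad_bump 100)) x = 2 * A + 4 * X * Z"
    using pd_quad_bump(2)[of 100 i x] i by (simp add: A_def Z_def X_def \<tau>_def)
  have val0: "pd i (pd i (quad_bump 100)) 0 = 2 * exp (- 100)"
    using pd_quad_bump(2)[of 100 i 0] i by (simp add: flat_def)
  have A_le: "A \<le> exp (- 100)" and AZ_le: "A + 2 * \<tau> * Z \<le> exp (- 100)"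
  proof -
    have "A \<le> exp (- 100) \<and> A + 2 * \<tau> * Z \<le> exp (- 100)"
    proof (cases "\<tau> < 1")
      case False
      then show ?thesis by (simp add: A_def Z_def flat_def)
    next
      case True
      define y where "y = 1 / (1 - \<tau>)"
      have y: "y \<ge> 1" using True \<tau>0 by (simp add: y_def)
      define \<sigma> where "\<sigma> = 100 * (y - 1)"
      have \<sigma>0: "\<sigma> \<ge> 0" using y by (simp add: \<sigma>_def)
      have ty: "\<tau> * y = \<sigma> / 100" using True by (simp add: \<sigma>_def y_def field_simps)
      have yy: "y = 1 + \<sigma> / 100" by (simp add: \<sigma>_def field_simps)
      \<comment> \<open>\<open>E\<close> is the common factor
        \<open>exp (- 100 / (1 - \<tau>))\<close> of all the \<open>flat\<close> terms. Since
        \<open>E * exp \<sigma> = exp (- 100)\<close>, dividing by it turns both claims into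
        comparisons with \<open>exp \<sigma>\<close>.\<close>
      define E where "E = exp (- 100) * exp (- \<sigma>)"
      have E: "E > 0" by (simp add: E_def)
      have Eexp: "E * exp \<sigma> = exp (- 100)" by (simp add: E_def exp_minus)
      have fl: "flat 100 j (1 - \<tau>) = E * y ^ j" for j
      proof -
        have "exp (- 100 / (1 - \<tau>)) = E"
          using True by (simp add: E_def \<sigma>_def y_def exp_add[symmetric] field_simps)
        then show ?thesis using True by (simp add: flat_def y_def power_divide)
      qed
      have A: "A = E * (1 - \<sigma> * y)"
      proof -
        have "A = E * (1 - 100 * (\<tau> * y) * y)"
          unfolding A_def fl by (simp add: algebra_simps power2_eq_square)
        then show ?thesis unfolding ty by simp
      qed
      have Z: "2 * \<tau> * Z = E * (- 4 * \<sigma> * y + 2 * \<sigma>\<^sup>2 * y\<^sup>2 - \<sigma>\<^sup>2 * y / 25)"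
      proof -
        have "2 * \<tau> * Z = E * (- 400 * (\<tau> * y) * y + 20000 * (\<tau> * y)\<^sup>2 * y\<^sup>2 - 400 * (\<tau> * y)\<^sup>2 * y)"
          unfolding Z_def fl by (simp add: algebra_simps eval_nat_numeral)
        then show ?thesis unfolding ty by (simp add: field_simps power2_eq_square)
      qed
      define m where "m = \<sigma> + \<sigma>\<^sup>2 / 100"
      have m: "\<sigma> * y = m" unfolding yy m_def by (simp add: algebra_simps power2_eq_square)
      have "1 - \<sigma> * y \<le> 1" using \<sigma>0 y by simp
      also have "1 \<le> exp \<sigma>" using \<sigma>0 by simp
      finally have "E * (1 - \<sigma> * y) \<le> E * exp \<sigma>" using E by (intro mult_left_mono) auto
      then have 1: "A \<le> exp (- 100)" by (simp only: A Eexp)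
      \<comment> \<open>The discarded term \<open>- \<sigma>\<^sup>2 * y / 25\<close> is
        nonpositive, and the rest depends only on \<open>\<sigma> * y\<close>, which is the
        \<open>m\<close> of \<open>exp_ge_quadratic\<close>.\<close>
      have "(1 - \<sigma> * y) + (- 4 * \<sigma> * y + 2 * \<sigma>\<^sup>2 * y\<^sup>2 - \<sigma>\<^sup>2 * y / 25) \<le> 1 - 5 * (\<sigma> * y) + 2 * (\<sigma> * y)\<^sup>2"
        using \<sigma>0 y by (simp add: power_mult_distrib)
      also have "\<dots> \<le> exp \<sigma>" unfolding m m_def by (rule exp_ge_quadratic[OF \<sigma>0])
      finally have "E * ((1 - \<sigma> * y) + (- 4 * \<sigma> * y + 2 * \<sigma>\<^sup>2 * y\<^sup>2 - \<sigma>\<^sup>2 * y / 25)) \<le> E * exp \<sigma>"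
        using E by (intro mult_left_mono) auto
      then have "A + 2 * \<tau> * Z \<le> exp (- 100)"
        by (simp only: A Z Eexp distrib_left)
      with 1 show ?thesis by simp
    qed
    then show "A \<le> exp (- 100)" "A + 2 * \<tau> * Z \<le> exp (- 100)" by auto
  qed
  have "2 * A + 4 * X * Z \<le> 2 * exp (- 100)"
  proof (cases "Z \<ge> 0")
    case True
    then have "X * Z \<le> \<tau> * Z" using X by (intro mult_right_mono)
    then show ?thesis using AZ_le by simp
  next
    case False
    then have "X * Z \<le> 0" using X by (simp add: mult_nonneg_nonpos)
    then show ?thesis using A_le by simp
  qed
  then show ?thesis by (simp add: val val0)
qed

section \<open>Parity, radial profiles and division by the squared norm\<close>

text \<open>The factor \<sigma> lets one statement cover even and odd functions, so that iterating
  it tracks the parity of all the derivatives of a radial function.\<close>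

lemma pd_reflect:
  assumes f: "test_fun UNIV f" and i: "i \<in> Basis" and r: "\<And>x. f (- x) = \<sigma> * f x"
  shows "pd i f (- x) = - \<sigma> * pd i f x"
proof (rule pd_line_eqI[OF f i])
  have "f (- x + t *\<^sub>R i) = \<sigma> * f (x + (- t) *\<^sub>R i)" for t
    using r[of "x + (- t) *\<^sub>R i"] by (simp add: algebra_simps)
  moreover have "((\<lambda>t. \<sigma> * f (x + (- t) *\<^sub>R i)) has_real_derivative \<sigma> * (pd i f x * (- 1))) (at 0)"
    using DERIV_chain2[OF test_fun_DERIV_pd[OF f i, of x "- 0"] DERIV_minus[OF DERIV_ident]]
    by (intro DERIV_cmult) simp
  ultimately show "((\<lambda>t. f (- x + t *\<^sub>R i)) has_real_derivative - \<sigma> * pd i f x) (at 0)"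
    by simp
qed

lemma frac_lap_odd_zero:
  assumes "\<And>x. f (- x) = - f x"
  shows "frac_lap s f 0 = 0"
proof -
  have "f 0 = 0" using assms[of 0] by simp
  then have "diff2 f 0 z = 0" for z using assms[of z] by (simp add: diff2_def)
  then show ?thesis by (simp add: frac_lap_def)
qed

text \<open>Away from 0 the gradient is \<open>q' (norm x)\<close> times the unit direction, which
  has no limit at 0. The linear bound on \<open>q'\<close> forces the product to tend to 0, and the
  quadratic bound on \<open>q - a\<close> makes 0 the derivative at the origin.\<close>

lemma C1_on_radial:
  fixes q q' :: "real \<Rightarrow> real"
  assumes d: "\<And>t. t > 0 \<Longrightarrow> (q has_real_derivative q' t) (at t)"
    and c: "continuous_on {0<..} q'"
    and q0: "\<And>t. 0 < t \<Longrightarrow> \<bar>q t - a\<bar> \<le> K * t\<^sup>2"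
    and q1: "\<And>t. 0 < t \<Longrightarrow> \<bar>q' t\<bar> \<le> K * t"
  shows "C1_on UNIV (\<lambda>x::'a::euclidean_space. if x = 0 then a else q (norm x))"
  unfolding C1_on_def
proof (intro exI conjI ballI)
  let ?Q = "\<lambda>x::'a. if x = 0 then a else q (norm x)"
  \<comment> \<open>As \<open>sgn 0 = 0\<close>, the same formula gives the gradient 0 at the
    origin.\<close>
  define g where "g x = q' (norm x) *\<^sub>R sgn x" for x :: 'a
  have K: "K \<ge> 0" using q1[of 1] by simp
  fix x :: 'a
  show "(?Q has_derivative (\<lambda>h. g x \<bullet> h)) (at x)"
  proof (cases "x = 0")
    case False
    have "((\<lambda>x. q (norm x)) has_derivative (\<lambda>h. q' (norm x) * (h \<bullet> sgn x))) (at x)"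
      using has_derivative_compose[OF has_derivative_norm[OF False] d[of "norm x", unfolded has_field_derivative_def]] False
      by simp
    then have "(?Q has_derivative (\<lambda>h. q' (norm x) * (h \<bullet> sgn x))) (at x)"
      by (rule has_derivative_transform_within_open[where s="- {0}"]) (use False in auto)
    then show ?thesis by (simp add: g_def inner_commute)
  next
    case True
    have "(?Q has_derivative (\<lambda>h. 0)) (at 0)"
      unfolding has_derivative_at_alt
    proof (intro conjI allI impI)
      fix e :: real assume e: "0 < e"
      show "\<exists>d>0. \<forall>y. norm (y - 0) < d \<longrightarrow> norm (?Q y - ?Q 0 - 0) \<le> e * norm (y - 0)"
      proof (intro exI[of _ "e / (K + 1)"] conjI allI impI)
        show "0 < e / (K + 1)" using e K by simp
        fix y :: 'a assume y: "norm (y - 0) < e / (K + 1)"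
        show "norm (?Q y - ?Q 0 - 0) \<le> e * norm (y - 0)"
        proof (cases "y = 0")
          case False
          have "K * norm y \<le> (K + 1) * norm y" by (simp add: distrib_right)
          also have "\<dots> \<le> e" using y K by (simp add: field_simps)
          finally have "K * norm y * norm y \<le> e * norm y" by (intro mult_right_mono) auto
          moreover have "\<bar>q (norm y) - a\<bar> \<le> K * norm y * norm y"
            using q0[of "norm y"] False by (simp add: power2_eq_square)
          ultimately have "\<bar>q (norm y) - a\<bar> \<le> e * norm y" by (rule order_trans[rotated])
          then show ?thesis using False by simp
        qed simp
      qed
    qed simp
    then show ?thesis using True by (simp add: g_def)
  qed
next
  let ?g = "\<lambda>x::'a. q' (norm x) *\<^sub>R sgn x"
  have K: "K \<ge> 0" using q1[of 1] by simp
  have "isCont ?g x" for x :: 'a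
  proof (cases "x = 0")
    case False
    have "continuous_on (- {0}) ?g"
      by (intro continuous_on_scaleR continuous_on_compose2[OF c] continuous_intros continuous_on_sgn) auto
    then show ?thesis using False by (simp add: continuous_on_eq_continuous_at open_Compl)
  next
    case True
    have "(?g \<longlongrightarrow> 0) (at 0)"
    proof (rule Lim_null_comparison)
      show "\<forall>\<^sub>F x in at 0. norm (?g x) \<le> K * norm x"
        using q1 by (auto simp: eventually_at_filter norm_sgn)
      show "((\<lambda>x. K * norm x) \<longlongrightarrow> 0) (at (0::'a))"
        by (auto intro!: tendsto_eq_intros)
    qed
    then show ?thesis using True by (simp add: isCont_def)
  qed
  then show "continuous_on UNIV ?g" by (simp add: continuous_at_imp_continuous_on)
qed

text \<open>Expanding \<open>D 0\<close> at 0 to order four removes the cubic remainders that would obstruct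
  differentiability of the quotient at the origin.\<close>

lemma C1_on_even_quotient:
  fixes D :: "nat \<Rightarrow> real \<Rightarrow> real"
  assumes D: "\<And>m t. (D m has_real_derivative D (Suc m) t) (at t)"
    and odd: "D 1 0 = 0" "D 3 0 = 0" and M: "\<And>t. \<bar>D 4 t\<bar> \<le> M"
  shows "C1_on UNIV (\<lambda>x::'a::euclidean_space.
           if x = 0 then D 2 0 / 2 else (D 0 (norm x) - D 0 0) / (norm x)\<^sup>2)"
proof (rule C1_on_radial[where q'="\<lambda>t. D 1 t / t\<^sup>2 - 2 * (D 0 t - D 0 0) / t ^ 3" and K=M])
  have M0: "M \<ge> 0" using M[of 0] by simp
  have r0: "\<bar>D 0 t - (D 0 0 + D 2 0 / 2 * t\<^sup>2)\<bar> \<le> M / 24 * t ^ 4" if "t > 0" for t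
  proof -
    obtain r where "D 0 t = (\<Sum>m<4. D m 0 / fact m * t ^ m) + D 4 r / fact 4 * t ^ 4"
      using Maclaurin_all_le[of D "D 0" t 4] D by blast
    then have "D 0 t - (D 0 0 + D 2 0 / 2 * t\<^sup>2) = D 4 r / 24 * t ^ 4"
      using odd by (simp add: eval_nat_numeral)
    also have "\<bar>\<dots>\<bar> = \<bar>D 4 r\<bar> / 24 * t ^ 4" using that by (simp add: abs_mult)
    also have "\<dots> \<le> M / 24 * t ^ 4" using M that by (intro mult_right_mono divide_right_mono) auto
    finally show ?thesis .
  qed
  have r1: "\<bar>D 1 t - D 2 0 * t\<bar> \<le> M / 6 * t ^ 3" if "t > 0" for t
  proof -
    obtain r where "D 1 t = (\<Sum>m<3. D (Suc m) 0 / fact m * t ^ m) + D (Suc 3) r / fact 3 * t ^ 3"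
      using Maclaurin_all_le[of "\<lambda>m. D (Suc m)" "D 1" t 3] D by auto
    then have "D 1 t - D 2 0 * t = D 4 r / 6 * t ^ 3"
      using odd by (simp add: eval_nat_numeral)
    also have "\<bar>\<dots>\<bar> = \<bar>D 4 r\<bar> / 6 * t ^ 3" using that by (simp add: abs_mult)
    also have "\<dots> \<le> M / 6 * t ^ 3" using M that by (intro mult_right_mono divide_right_mono) auto
    finally show ?thesis .
  qed
  have D0: "(D 0 has_real_derivative D 1 t) (at t)" for t using D[of 0 t] by simp
  fix t :: real assume t: "t > 0"
  show "((\<lambda>t. (D 0 t - D 0 0) / t\<^sup>2) has_real_derivative D 1 t / t\<^sup>2 - 2 * (D 0 t - D 0 0) / t ^ 3) (at t)"
    using t by (auto intro!: derivative_eq_intros D0 simp: field_simps power2_eq_square power3_eq_cube)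
  show "\<bar>(D 0 t - D 0 0) / t\<^sup>2 - D 2 0 / 2\<bar> \<le> M * t\<^sup>2"
  proof -
    have "(D 0 t - D 0 0) / t\<^sup>2 - D 2 0 / 2 = (D 0 t - (D 0 0 + D 2 0 / 2 * t\<^sup>2)) / t\<^sup>2"
      using t by (simp add: field_simps)
    also have "\<bar>\<dots>\<bar> \<le> M / 24 * t ^ 4 / t\<^sup>2"
      using divide_right_mono[OF r0[OF t], of "t\<^sup>2"] by simp
    also have "\<dots> = M / 24 * t\<^sup>2" using t by (simp add: eval_nat_numeral)
    also have "\<dots> \<le> M * t\<^sup>2" using M0 by (intro mult_right_mono) auto
    finally show ?thesis .
  qed
  show "\<bar>D 1 t / t\<^sup>2 - 2 * (D 0 t - D 0 0) / t ^ 3\<bar> \<le> M * t"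
  proof -
    define A B where "A = D 0 t - (D 0 0 + D 2 0 / 2 * t\<^sup>2)" and "B = D 1 t - D 2 0 * t"
    have AB: "\<bar>A\<bar> \<le> M / 24 * t ^ 4" "\<bar>B\<bar> \<le> M / 6 * t ^ 3"
      using r0[OF t] r1[OF t] by (simp_all add: A_def B_def)
    \<comment> \<open>The singular contributions \<open>D 2 0 / t\<close> of the two terms cancel,
      so only the Taylor remainders \<open>A\<close> and \<open>B\<close> are left.\<close>
    have "D 1 t / t\<^sup>2 - 2 * (D 0 t - D 0 0) / t ^ 3 = B / t\<^sup>2 - 2 * (A / t ^ 3)"
      using t by (simp add: A_def B_def field_simps power2_eq_square power3_eq_cube)
    also have "\<bar>\<dots>\<bar> \<le> \<bar>B / t\<^sup>2\<bar> + 2 * \<bar>A / t ^ 3\<bar>"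
      by linarith
    also have "\<dots> \<le> M / 6 * t ^ 3 / t\<^sup>2 + 2 * (M / 24 * t ^ 4 / t ^ 3)"
      using divide_right_mono[OF AB(2), of "t\<^sup>2"] divide_right_mono[OF AB(1), of "t ^ 3"] t
      by (intro add_mono mult_left_mono) (simp_all add: abs_divide)
    also have "\<dots> = M / 4 * t" using t by (simp add: eval_nat_numeral)
    also have "\<dots> \<le> M * t" using M0 t by (intro mult_right_mono) auto
    finally show ?thesis .
  qed
next
  have "continuous_on {0<..} (D m)" for m
    using D DERIV_isCont continuous_at_imp_continuous_on by blast
  then show "continuous_on {0<..} (\<lambda>t. D 1 t / t\<^sup>2 - 2 * (D 0 t - D 0 0) / t ^ 3)"
    by (intro continuous_intros) auto
qed

text \<open>A radial function is determined by its profile on the line through \<open>i\<close>. The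
  derivatives of that profile are the fractional Laplacians of the iterated partial derivatives, and
  those of odd order vanish at 0 because they come from odd functions.\<close>

lemma frac_lap_even_quotient:
  fixes f :: "'a::euclidean_space \<Rightarrow> real"
  assumes s: "0 < s" "s < 1" and f: "test_fun UNIV f" and rad: "radial f" and i: "i \<in> Basis"
  obtains Q where "C1_on UNIV Q" "radial Q" "Q 0 = frac_lap s (pd i (pd i f)) 0 / 2"
    "\<And>x. frac_lap s f x = frac_lap s f 0 + (norm x)\<^sup>2 * Q x"
proof -
  define D where "D m t = frac_lap s ((pd i ^^ m) f) (t *\<^sub>R i)" for m t
  have t: "test_fun UNIV ((pd i ^^ m) f)" for m by (rule test_fun_pd_funpow[OF f i])
  have D: "(D m has_real_derivative D (Suc m) t) (at t)" for m t
    unfolding D_def using DERIV_frac_lap[OF s t i, where x=0] by simp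
  have parity: "((pd i ^^ m) f) (- x) = (- 1) ^ m * ((pd i ^^ m) f) x" for m x
  proof (induction m arbitrary: x)
    case 0
    show ?case using rad[unfolded radial_def, rule_format, of "- x" x] by simp
  next
    case (Suc m)
    from pd_reflect[OF t i Suc, of x] show ?case by (simp only: funpow.simps comp_apply power_Suc)
  qed
  have "D m 0 = 0" if "odd m" for m
    unfolding D_def scaleR_zero_left by (rule frac_lap_odd_zero) (simp add: parity that)
  then have odd: "D 1 0 = 0" "D 3 0 = 0" by simp_all
  obtain M where "0 \<le> M" "\<And>x. \<bar>frac_lap s ((pd i ^^ 4) f) x\<bar> \<le> M"
    by (rule frac_lap_bounded[OF s t[of 4]]) blast
  then have M: "\<bar>D 4 t\<bar> \<le> M" for t by (simp only: D_def)
  have nx: "frac_lap s f x = D 0 (norm x)" for x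
    using frac_lap_radial[OF f rad, of s, unfolded radial_def, rule_format, of x "norm x *\<^sub>R i"] i
    by (simp add: D_def)
  let ?Q = "\<lambda>x::'a. if x = 0 then D 2 0 / 2 else (D 0 (norm x) - D 0 0) / (norm x)\<^sup>2"
  show ?thesis
  proof
    show "C1_on UNIV ?Q" by (rule C1_on_even_quotient[OF D odd M])
    show "radial ?Q" by (auto simp: radial_def)
    show "?Q 0 = frac_lap s (pd i (pd i f)) 0 / 2" by (simp add: D_def numeral_2_eq_2)
    show "frac_lap s f x = frac_lap s f 0 + (norm x)\<^sup>2 * ?Q x" for x
      by (simp add: nx)
  qed
qed

section \<open>Strict positivity at a global maximum\<close>

lemma open_not_AE_notin:
  fixes S :: "'a::euclidean_space set"
  assumes "open S" "S \<noteq> {}"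
  shows "\<not> (AE x in lborel. x \<notin> S)"
proof
  assume "AE x in lborel. x \<notin> S"
  then have "S \<in> null_sets lborel"
    using assms(1) by (subst AE_iff_null_sets) (auto simp: borel_open)
  then have "negligible S"
    by (simp add: negligible_iff_null_sets null_sets_completionI)
  then show False using open_not_negligible[OF assms] by simp
qed

text \<open>At the maximum every second difference is nonnegative. Beyond the support it equals
  \<open>2 * g 0 > 0\<close>, so nonlocality makes the integral strictly positive.\<close>

lemma frac_lap_pos_at_max:
  fixes g :: "'a::euclidean_space \<Rightarrow> real"
  assumes s: "0 < s" "s < 1" and g: "test_fun UNIV g"
    and max: "\<And>x. g x \<le> g 0" and pos: "g 0 > 0"
  shows "frac_lap s g 0 > 0"
proof -
  let ?p = "real DIM('a) + 2 * s"
  let ?h = "\<lambda>z. diff2 g 0 z / norm z powr ?p"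
  obtain R where R: "R > 0" "\<And>x. norm x > R \<Longrightarrow> g x = 0"
    using test_fun_zero_outside[OF g] by blast
  have nn: "?h z \<ge> 0" for z
    using max[of z] max[of "- z"] by (simp add: diff2_def)
  have i: "integrable lborel ?h" by (rule integrable_frac_lap[OF s g])
  have "frac_lap s g 0 \<noteq> 0"
  proof
    assume "frac_lap s g 0 = 0"
    then have ae0: "AE z in lborel. ?h z = 0"
      using integral_nonneg_eq_0_iff_AE[OF i] nn by (simp add: frac_lap_def)
    have nz: "?h z \<noteq> 0" if "norm z > R" for z
      using R that pos by (auto simp: diff2_def)
    have ae: "AE z::'a in lborel. norm z \<le> R"
      by (rule eventually_mono[OF ae0]) (use nz not_less in blast)
    obtain e :: 'a where e: "e \<in> Basis" using nonempty_Basis by blast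
    \<comment> \<open>Any nonempty open set outside the closed ball of radius \<open>R\<close> would
      do; this one touches it only in its closure.\<close>
    have "AE z in lborel. z \<notin> ball ((R + 1) *\<^sub>R e) 1"
    proof (rule eventually_mono[OF ae])
      fix z :: 'a assume z: "norm z \<le> R"
      have "norm ((R + 1) *\<^sub>R e) = R + 1" using e R by simp
      then show "z \<notin> ball ((R + 1) *\<^sub>R e) 1"
        using z norm_triangle_ineq2[of "(R + 1) *\<^sub>R e" z] by (simp add: dist_norm)
    qed
    then show False using open_not_AE_notin[of "ball ((R + 1) *\<^sub>R e) 1"] by simp
  qed
  moreover have "frac_lap s g 0 \<ge> 0" unfolding frac_lap_def using nn by (rule Bochner_Integration.integral_nonneg)
  ultimately show ?thesis by simp
qed

section \<open>Potentials of class C1 and the construction\<close>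

lemma C1_onE:
  assumes "C1_on S f"
  obtains g where "\<And>x. x \<in> S \<Longrightarrow> (f has_derivative (\<lambda>h. g x \<bullet> h)) (at x)" "continuous_on S g"
  using assms unfolding C1_on_def by blast

lemma C1_onI:
  assumes "\<And>x. x \<in> S \<Longrightarrow> (f has_derivative (\<lambda>h. g x \<bullet> h)) (at x)" "continuous_on S g"
  shows "C1_on S f"
  using assms unfolding C1_on_def by blast

lemma C1_on_subset:
  assumes "C1_on S f" "T \<subseteq> S"
  shows "C1_on T f"
proof -
  obtain g where "\<And>x. x \<in> S \<Longrightarrow> (f has_derivative (\<lambda>h. g x \<bullet> h)) (at x)" "continuous_on S g"
    using C1_onE[OF assms(1)] by blast
  then show ?thesis using assms(2) by (intro C1_onI[of T f g]) (auto intro: continuous_on_subset)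
qed

lemma C1_on_imp_continuous_on:
  assumes "C1_on S f"
  shows "continuous_on S f"
proof -
  obtain g where "\<And>x. x \<in> S \<Longrightarrow> (f has_derivative (\<lambda>h. g x \<bullet> h)) (at x)"
    using C1_onE[OF assms] by blast
  then show ?thesis
    by (intro continuous_at_imp_continuous_on ballI) (rule has_derivative_continuous)
qed

lemma C1_on_lincomb:
  fixes f g :: "'a::euclidean_space \<Rightarrow> real"
  assumes "C1_on UNIV f" "C1_on UNIV g"
  shows "C1_on UNIV (\<lambda>x. a * f (c *\<^sub>R x) + b * g (d *\<^sub>R x))"
proof -
  obtain f' where f0: "\<And>x. x \<in> UNIV \<Longrightarrow> (f has_derivative (\<lambda>h. f' x \<bullet> h)) (at x)" "continuous_on UNIV f'"
    using C1_onE[OF assms(1)] by blast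
  obtain g' where g0: "\<And>x. x \<in> UNIV \<Longrightarrow> (g has_derivative (\<lambda>h. g' x \<bullet> h)) (at x)" "continuous_on UNIV g'"
    using C1_onE[OF assms(2)] by blast
  note f = f0(1)[OF UNIV_I] f0(2) and g = g0(1)[OF UNIV_I] g0(2)
  have sc: "((\<lambda>x. c *\<^sub>R x) has_derivative (\<lambda>h. c *\<^sub>R h)) (at x)" for c and x :: 'a
    by (auto intro!: derivative_eq_intros)
  have "((\<lambda>x. a * f (c *\<^sub>R x) + b * g (d *\<^sub>R x)) has_derivative
      (\<lambda>h. ((a * c) *\<^sub>R f' (c *\<^sub>R x) + (b * d) *\<^sub>R g' (d *\<^sub>R x)) \<bullet> h)) (at x)" for x
  proof (rule has_derivative_eq_rhs)
    have F: "((\<lambda>x. f (c *\<^sub>R x)) has_derivative (\<lambda>h. f' (c *\<^sub>R x) \<bullet> (c *\<^sub>R h))) (at x)"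
      by (rule has_derivative_compose[OF sc f(1)])
    have G: "((\<lambda>x. g (d *\<^sub>R x)) has_derivative (\<lambda>h. g' (d *\<^sub>R x) \<bullet> (d *\<^sub>R h))) (at x)"
      by (rule has_derivative_compose[OF sc g(1)])
    show "((\<lambda>x. a * f (c *\<^sub>R x) + b * g (d *\<^sub>R x)) has_derivative
        (\<lambda>h. a * (f' (c *\<^sub>R x) \<bullet> (c *\<^sub>R h)) + b * (g' (d *\<^sub>R x) \<bullet> (d *\<^sub>R h)))) (at x)"
      by (rule has_derivative_add[OF has_derivative_mult_right[OF F] has_derivative_mult_right[OF G]])
  qed (simp add: inner_add_left mult.assoc)
  moreover have "continuous_on UNIV (\<lambda>x. f' (c *\<^sub>R x))" "continuous_on UNIV (\<lambda>x. g' (d *\<^sub>R x))"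
    by (rule continuous_on_compose2[OF f(2)] continuous_on_compose2[OF g(2)]; auto intro!: continuous_intros)+
  then have "continuous_on UNIV (\<lambda>x. (a * c) *\<^sub>R f' (c *\<^sub>R x) + (b * d) *\<^sub>R g' (d *\<^sub>R x))"
    by (intro continuous_on_add continuous_on_scaleR continuous_on_const)
  ultimately show ?thesis
    by (intro C1_onI[where g="\<lambda>x. (a * c) *\<^sub>R f' (c *\<^sub>R x) + (b * d) *\<^sub>R g' (d *\<^sub>R x)"])
qed

lemma C1_on_divide:
  fixes f g :: "'a::euclidean_space \<Rightarrow> real"
  assumes "C1_on S f" "C1_on S g" and nz: "\<And>x. x \<in> S \<Longrightarrow> g x \<noteq> 0"
  shows "C1_on S (\<lambda>x. a * f x / g x)"
proof -
  obtain f' where f: "\<And>x. x \<in> S \<Longrightarrow> (f has_derivative (\<lambda>h. f' x \<bullet> h)) (at x)" "continuous_on S f'"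
    using C1_onE[OF assms(1)] by blast
  obtain g' where g: "\<And>x. x \<in> S \<Longrightarrow> (g has_derivative (\<lambda>h. g' x \<bullet> h)) (at x)" "continuous_on S g'"
    using C1_onE[OF assms(2)] by blast
  let ?d = "\<lambda>x. (a / g x) *\<^sub>R f' x - (a * f x / (g x)\<^sup>2) *\<^sub>R g' x"
  have "((\<lambda>x. a * f x / g x) has_derivative (\<lambda>h. ?d x \<bullet> h)) (at x)" if x: "x \<in> S" for x
    by (rule has_derivative_eq_rhs, rule has_derivative_divide'[OF has_derivative_mult_right[OF f(1)[OF x]] g(1)[OF x] nz[OF x]])
       (use nz[OF x] in \<open>simp add: fun_eq_iff inner_diff_left field_simps power2_eq_square\<close>)
  moreover have "continuous_on S ?d"
    using C1_on_imp_continuous_on[OF assms(1)] C1_on_imp_continuous_on[OF assms(2)]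
    by (intro continuous_on_diff continuous_on_scaleR continuous_on_divide continuous_on_mult
        continuous_on_power continuous_on_const f(2) g(2)) (auto simp: nz)
  ultimately show ?thesis by (intro C1_onI[where g="?d"])
qed

lemma smooth_fun_imp_C1_on:
  fixes f :: "'a::euclidean_space \<Rightarrow> real"
  assumes "smooth_fun f"
  shows "C1_on UNIV f"
proof -
  have "(f has_derivative (\<lambda>h. (\<Sum>i\<in>Basis. pd i f x *\<^sub>R i) \<bullet> h)) (at x)" for x
    using differentiable_has_derivative_pd[OF smooth_fun_differentiable[OF assms], of x]
    unfolding inner_sum_left inner_scaleR_left by (simp only: inner_commute mult.commute)
  moreover have "continuous_on UNIV (\<lambda>x. \<Sum>i\<in>Basis. pd i f x *\<^sub>R i)"
    by (intro continuous_on_sum continuous_on_scaleR continuous_on_const smooth_fun_continuous smooth_fun_pd assms)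
  ultimately show ?thesis by (intro C1_onI[where g="\<lambda>x. \<Sum>i\<in>Basis. pd i f x *\<^sub>R i"])
qed

lemma C1_on_ball_imp_holder_loc:
  fixes f :: "'a::euclidean_space \<Rightarrow> real"
  assumes f: "C1_on (ball 0 1) f" and \<alpha>: "0 < \<alpha>" "\<alpha> \<le> 1"
  shows "holder_loc \<alpha> (ball 0 1) f"
  unfolding holder_loc_def
proof (intro conjI allI impI)
  show "continuous_on (ball 0 1) f" by (rule C1_on_imp_continuous_on[OF f])
  obtain g where g: "\<And>x. x \<in> ball 0 1 \<Longrightarrow> (f has_derivative (\<lambda>h. g x \<bullet> h)) (at x)"
      "continuous_on (ball 0 1) g"
    using C1_onE[OF f] by blast
  fix K :: "'a set" assume K: "compact K \<and> K \<subseteq> ball 0 1"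
  show "\<exists>C. \<forall>x\<in>K. \<forall>y\<in>K. \<bar>f x - f y\<bar> \<le> C * norm (x - y) powr \<alpha>"
  proof (cases "K = {}")
    case False
    \<comment> \<open>\<open>K\<close> need not be convex, so it is enclosed in a concentric closed
      ball inside the unit ball, where the mean value inequality applies.\<close>
    have "compact (norm ` K)" using K by (intro compact_continuous_image continuous_intros) auto
    then obtain r where r: "r \<in> norm ` K" "\<forall>t\<in>norm ` K. t \<le> r"
      using compact_attains_sup[of "norm ` K"] False by blast
    from r(1) have r1: "r < 1" using K by auto
    then have sub: "cball 0 r \<subseteq> ball (0::'a) 1" by (auto simp: subset_iff)
    have "bounded (g ` cball 0 r)"
      using continuous_on_subset[OF g(2) sub] by (intro compact_imp_bounded compact_continuous_image) auto
    then obtain B where B: "\<forall>y\<in>g ` cball 0 r. norm y \<le> B"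
      unfolding bounded_iff by blast
    have "\<bar>f x - f y\<bar> \<le> (2 * \<bar>B\<bar>) * norm (x - y) powr \<alpha>" if xy: "x \<in> K" "y \<in> K" for x y
    proof (cases "x = y")
      case False
      have x: "x \<in> cball 0 r" and y: "y \<in> cball 0 r"
        using r(2)[rule_format, OF imageI[OF xy(1)]] r(2)[rule_format, OF imageI[OF xy(2)]] by simp_all
      have "norm (f x - f y) \<le> \<bar>B\<bar> * norm (x - y)"
      proof (rule differentiable_bound[where S="cball 0 r" and f'="\<lambda>x h. g x \<bullet> h"])
        fix z :: 'a assume z: "z \<in> cball 0 r"
        show "(f has_derivative (\<lambda>h. g z \<bullet> h)) (at z within cball 0 r)"
          by (rule has_derivative_at_withinI[OF g(1)]) (use z sub in blast)
        have "norm (g z) \<le> \<bar>B\<bar>" using B[rule_format, OF imageI[OF z]] by simp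
        then have "norm (g z \<bullet> h) \<le> \<bar>B\<bar> * norm h" for h
          using order_trans[OF Cauchy_Schwarz_ineq2[of "g z" h] mult_right_mono[of "norm (g z)" "\<bar>B\<bar>" "norm h"]]
          by simp
        then show "onorm (\<lambda>h. g z \<bullet> h) \<le> \<bar>B\<bar>"
          by (intro onorm_bound) simp_all
      qed (use x y in auto)
      \<comment> \<open>The two points are at most 2 apart; half the distance is at most 1, where
        lowering the exponent from 1 to \<alpha> can only increase the power.\<close>
      also have "norm (x - y) \<le> 2 * norm (x - y) powr \<alpha>"
      proof -
        let ?t = "norm (x - y)"
        have t: "0 < ?t" "?t \<le> 2"
          using False norm_triangle_ineq4[of x y] x y r1 by auto
        have "?t = 2 * (?t / 2) powr 1" using t by simp
        also have "\<dots> \<le> 2 * (?t / 2) powr \<alpha>"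
          using t \<alpha> by (intro mult_left_mono powr_mono') auto
        also have "\<dots> \<le> 2 * ?t powr \<alpha>"
          using t \<alpha> by (intro mult_left_mono powr_mono2) auto
        finally show ?thesis .
      qed
      finally show ?thesis by (simp add: mult_left_mono)
    qed simp
    then show ?thesis by (intro exI[of _ "2 * \<bar>B\<bar>"] ballI)
  qed simp
qed

lemma C1_on_ball_growth_bound:
  fixes V :: "'a::euclidean_space \<Rightarrow> real"
  assumes "C1_on (ball 0 1) V" and s: "s > 0"
  shows "\<exists>g::'a \<Rightarrow> 'a. (\<forall>x\<in>ball 0 1 - {0}. (V has_derivative (\<lambda>h. g x \<bullet> h)) (at x)) \<and>
        (\<exists>CV>0. \<exists>\<epsilon>>0. eventually (\<lambda>x. \<bar>V x\<bar> + \<bar>x \<bullet> g x\<bar> \<le> CV * norm x powr (- 2 * s + \<epsilon>)) (at 0))"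
proof -
  obtain g where g: "\<And>x. x \<in> ball 0 1 \<Longrightarrow> (V has_derivative (\<lambda>h. g x \<bullet> h)) (at x)"
      "continuous_on (ball 0 1) g"
    using C1_onE[OF assms(1)] by blast
  let ?C = "\<bar>V 0\<bar> + 1 + (norm (g 0) + 1)"
  have "isCont V 0" by (rule has_derivative_continuous[OF g(1)]) simp
  then have V: "\<forall>\<^sub>F x in at 0. \<bar>V x\<bar> < \<bar>V 0\<bar> + 1"
    unfolding isCont_def by (intro order_tendstoD(2)[OF tendsto_rabs]) auto
  have "isCont g 0" using g(2) by (simp add: continuous_on_eq_continuous_at)
  then have G: "\<forall>\<^sub>F x in at 0. norm (g x) < norm (g 0) + 1"
    unfolding isCont_def by (intro order_tendstoD(2)[OF tendsto_norm]) auto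
  have N: "\<forall>\<^sub>F x in at (0::'a). norm x < 1 \<and> x \<noteq> 0"
    by (auto simp: eventually_at intro!: exI[of _ 1])
  \<comment> \<open>With \<epsilon> chosen as \<open>2 * s\<close> the exponent is 0 and the claim
    is mere boundedness. The condition \<open>x \<noteq> 0\<close> in \<open>N\<close> is used
    because \<open>0 powr 0 = 0\<close>.\<close>
  have "\<forall>\<^sub>F x in at 0. \<bar>V x\<bar> + \<bar>x \<bullet> g x\<bar> \<le> ?C * norm x powr (- 2 * s + 2 * s)"
    using V G N
  proof eventually_elim
    case (elim x)
    have "\<bar>x \<bullet> g x\<bar> \<le> norm x * norm (g x)" by (rule Cauchy_Schwarz_ineq2)
    also have "\<dots> \<le> norm (g x)" using elim by (intro mult_left_le_one_le) auto
    finally show ?case using elim by simp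
  qed
  moreover have "?C > 0" by (intro add_pos_pos add_nonneg_pos) auto
  moreover have "2 * s > 0" using s by simp
  ultimately have "\<exists>CV>0. \<exists>\<epsilon>>0. eventually (\<lambda>x. \<bar>V x\<bar> + \<bar>x \<bullet> g x\<bar> \<le> CV * norm x powr (- 2 * s + \<epsilon>)) (at 0)"
    by blast
  moreover have "\<forall>x\<in>ball 0 1 - {0}. (V has_derivative (\<lambda>h. g x \<bullet> h)) (at x)"
    using g(1) by blast
  ultimately show ?thesis by blast
qed

section \<open>Normalising constant, zero set and assembly of the solution\<close>

text \<open>The denominator needs care because \<open>Gamma\<close> has the value 0 at its poles;
  \<open>- s\<close> lies strictly between the poles -1 and 0.\<close>

lemma C_Ns_pos:
  assumes "n > 0" "0 < s" "s < 1"
  shows "C_Ns n s > 0"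
proof -
  have "Gamma ((real n + 2 * s) / 2) > 0" using assms by (intro Gamma_real_pos) auto
  moreover have "- s \<notin> \<int>\<^sub>\<le>\<^sub>0"
  proof
    assume "- s \<in> \<int>\<^sub>\<le>\<^sub>0"
    then obtain k :: int where "- s = of_int k" by (auto elim: nonpos_Ints_cases)
    then have "k > -1" "k < 0" using assms by linarith+
    then show False by simp
  qed
  then have "Gamma (- s) \<noteq> 0" by (simp add: Gamma_eq_zero_iff)
  ultimately show ?thesis unfolding C_Ns_def by simp
qed

lemma test_fun_in_Ds2:
  assumes "test_fun UNIV u"
  shows "u \<in> Ds2 s"
  unfolding Ds2_def
proof (intro CollectI conjI exI[of _ "\<lambda>_. u"] allI)
  show "u \<in> borel_measurable lborel" using test_fun_measurable[OF assms] by simp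
qed (use assms in \<open>simp_all add: gagliardo_sq_def\<close>)

lemma radial_bump: "radial (bump c)"
  unfolding radial_def bump_def by (metis dot_square_norm)

lemma radial_quad_bump: "radial (quad_bump c)"
  using radial_bump[of c] unfolding radial_def quad_bump_def by (metis dot_square_norm)

text \<open>With \<open>t\<close> standing for \<open>|x|^2\<close> this locates the zeros of the
  solution inside its supporting ball and away from the origin: they fill at most one sphere. For
  \<open>1 \<le> t < 4\<close> only the wider bump is nonzero, so a zero has \<open>t < 1\<close>.
  There, taking logarithms leaves the equation \<open>w t = - ln \<kappa> / 100\<close>, and
  \<open>w\<close> is injective.\<close>

lemma bump_difference_zero_unique:
  fixes \<kappa> :: real
  assumes \<kappa>: "\<kappa> > 0" and t: "0 \<le> t1" "t1 < 4" "0 \<le> t2" "t2 < 4"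
    and z: "flat 100 0 (1 - t1) = \<kappa> * flat 100 0 (1 - t1 / 4)"
      "flat 100 0 (1 - t2) = \<kappa> * flat 100 0 (1 - t2 / 4)"
  shows "t1 = t2"
proof -
  define w where "w t = 1 / (1 - t) - 1 / (1 - t / 4)" for t :: real
  have *: "t < 1 \<and> w t = - ln \<kappa> / 100"
    if t: "0 \<le> t" "t < 4" and z: "flat 100 0 (1 - t) = \<kappa> * flat 100 0 (1 - t / 4)" for t
  proof -
    have "flat 100 0 (1 - t) > 0" unfolding z using t \<kappa> by (simp add: flat_def)
    then have t1: "t < 1" by (simp add: flat_def split: if_splits)
    have fl: "flat 100 0 r = exp (- (100 * (1 / r)))" if "r > 0" for r using that by (simp add: flat_def)
    have "exp (- (100 * (1 / (1 - t)))) = \<kappa> * exp (- (100 * (1 / (1 - t / 4))))"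
      using z t t1 by (simp add: fl)
    also have "\<dots> = exp (ln \<kappa> + - (100 * (1 / (1 - t / 4))))"
      unfolding exp_add exp_ln[OF \<kappa>] ..
    finally have "- (100 * (1 / (1 - t))) = ln \<kappa> + - (100 * (1 / (1 - t / 4)))"
      by (simp only: exp_inj_iff)
    then have "w t = - ln \<kappa> / 100" unfolding w_def by linarith
    with t1 show ?thesis by simp
  qed
  have lt: "t1 < 1" "t2 < 1" and weq: "w t1 = w t2"
    using *[OF t(1,2) z(1)] *[OF t(3,4) z(2)] by simp_all
  have w: "w t = 3 * t / ((1 - t) * (4 - t))" if "t < 1" for t
    using that by (simp add: w_def field_simps)
  have nz: "(1 - t1) * (4 - t1) \<noteq> 0" "(1 - t2) * (4 - t2) \<noteq> 0" using lt by simp_all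
  have "3 * t1 * ((1 - t2) * (4 - t2)) = 3 * t2 * ((1 - t1) * (4 - t1))"
    using weq unfolding w[OF lt(1)] w[OF lt(2)] frac_eq_eq[OF nz] .
  \<comment> \<open>Cross multiplication leaves a polynomial divisible by \<open>t1 - t2\<close>;
    the cofactor stays positive since both arguments are below 1.\<close>
  then have "(t1 - t2) * (4 - t1 * t2) = 0" by (simp add: algebra_simps)
  moreover have "t1 * t2 \<le> 1" using lt t by (intro mult_le_one) auto
  ultimately show ?thesis by auto
qed


proposition exists_potential_and_solution:
  fixes s :: real
  assumes s: "0 < s" "s < 1"
  shows "\<exists>(V::'a::euclidean_space \<Rightarrow> real) u. thm12_props s V u \<and> C1_on (ball 0 1) V"
proof -
  obtain i :: 'a where i: "i \<in> Basis" using nonempty_Basis by blast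
  let ?v = "quad_bump 100 :: 'a \<Rightarrow> real" and ?b = "bump 100 :: 'a \<Rightarrow> real"
  \<comment> \<open>The weight \<open>2 powr (2 * s)\<close> of the second dilate meets
    \<open>|x / 2|^2\<close>, which is \<open>|x|^2 / 4\<close>. After \<open>|x|^2\<close> is
    factored out, \<kappa> is what multiplies the wider bump, and \<open>s < 1\<close> gives
    \<kappa> < 1.\<close>
  define \<kappa> where "\<kappa> = (2::real) powr (2 * s) / 4"
  have \<kappa>: "0 < \<kappa>" "\<kappa> < 1"
    using s powr_less_mono[of "2 * s" 2 2] by (auto simp: \<kappa>_def)
  have tv: "test_fun UNIV ?v" and tb: "test_fun UNIV ?b"
    by (simp_all add: test_fun_quad_bump test_fun_bump)
  have "frac_lap s (pd i (pd i ?v)) 0 > 0"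
  proof (rule frac_lap_pos_at_max[OF s])
    show "test_fun UNIV (pd i (pd i ?v))" by (rule test_fun_pd[OF test_fun_pd[OF tv i] i])
    show "pd i (pd i ?v) x \<le> pd i (pd i ?v) 0" for x by (rule pd_pd_quad_bump_le[OF i])
    show "0 < pd i (pd i ?v) 0" using pd_quad_bump(2)[of 100 i 0] i by (simp add: flat_def)
  qed
  then obtain Q where Q: "C1_on UNIV Q" "radial Q" "Q 0 > 0"
      "\<And>x. frac_lap s ?v x = frac_lap s ?v 0 + (norm x)\<^sup>2 * Q x"
    using frac_lap_even_quotient[OF s tv radial_quad_bump i] by (metis half_gt_zero)
  \<comment> \<open>Up to the zoom by \<delta>, \<open>n\<close> and \<open>m\<close> are what
    remains of the fractional Laplacian and of the solution after division by \<open>|x|^2\<close>.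
    Their values at 0 are \<open>3/4 * Q 0\<close> and
    \<open>(1 - \<kappa>) * exp (- 100)\<close>.\<close>
  define n where "n x = Q x - Q ((1/2) *\<^sub>R x) / 4" for x
  define m where "m x = ?b x - \<kappa> * ?b ((1/2) *\<^sub>R x)" for x
  have Cn: "C1_on UNIV (\<lambda>x. n (d *\<^sub>R x))" for d
    using C1_on_lincomb[OF Q(1) Q(1), of 1 d "- 1/4" "d / 2"] by (simp add: n_def)
  have Cb: "C1_on UNIV ?b" using tb by (intro smooth_fun_imp_C1_on) (simp add: test_fun_def)
  have Cm: "C1_on UNIV (\<lambda>x. m (d *\<^sub>R x))" for d
    using C1_on_lincomb[OF Cb Cb, of 1 d "- \<kappa>" "d / 2"] by (simp add: m_def)
  have rn: "n x = n y" and rm: "m x = m y" if xy: "norm x = norm y" for x y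
  proof -
    have "norm ((1/2) *\<^sub>R x) = norm ((1/2) *\<^sub>R y)" using xy by simp
    then show "n x = n y" "m x = m y"
      using Q(2)[unfolded radial_def, rule_format] radial_bump[unfolded radial_def, rule_format] xy
      unfolding n_def m_def by metis+
  qed
  \<comment> \<open>Positivity of \<open>n\<close> and \<open>m\<close> is only known near 0, so the
    ball of radius \<delta> is later blown up to the unit ball. The cap at 1 ensures that the
    support radius \<open>2 / \<delta>\<close> is at least 1.\<close>
  obtain \<delta> where \<delta>: "0 < \<delta>" "\<delta> \<le> 1" "\<And>x. norm x < \<delta> \<Longrightarrow> n x > 0 \<and> m x > 0"
  proof -
    have "isCont n 0" "isCont m 0"
      using C1_on_imp_continuous_on[OF Cn[of 1]] C1_on_imp_continuous_on[OF Cm[of 1]]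
      by (simp_all add: continuous_on_eq_continuous_at)
    moreover have "n 0 > 0" "m 0 > 0"
      using Q(3) \<kappa> by (simp_all add: n_def m_def bump_def flat_def)
    ultimately have "\<forall>\<^sub>F x in nhds 0. n x > 0" "\<forall>\<^sub>F x in nhds 0. m x > 0"
      unfolding continuous_at tendsto_at_iff_tendsto_nhds by (auto intro: order_tendstoD(1))
    then have "\<forall>\<^sub>F x in nhds 0. n x > 0 \<and> m x > 0" by (rule eventually_conj)
    then obtain d where d: "d > 0" "\<And>x. dist x 0 < d \<Longrightarrow> n x > 0 \<and> m x > 0"
      unfolding eventually_nhds_metric by blast
    show ?thesis by (rule that[of "min d 1"]) (use d in auto)
  qed
  define c where "c = C_Ns DIM('a) s / 2"
  have c: "c > 0" using C_Ns_pos[of "DIM('a)" s] s by (simp add: c_def)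
  \<comment> \<open>The factor \<open>c\<close> restores the normalisation that
    \<open>frac_lap\<close> omits, and \<open>\<delta> powr (2 * s)\<close> is the price of the
    zoom.\<close>
  define V where "V x = (c * \<delta> powr (2 * s)) * n (\<delta> *\<^sub>R x) / m (\<delta> *\<^sub>R x)" for x
  define u where "u x = 1 * ?v (\<delta> *\<^sub>R x) + (- (2 powr (2 * s))) * ?v ((\<delta> / 2) *\<^sub>R x)" for x
  have tu: "test_fun UNIV u"
    unfolding u_def[abs_def] by (rule test_fun_lincomb[OF tv tv]) (use \<delta> in auto)
  have u_m: "u x = (norm (\<delta> *\<^sub>R x))\<^sup>2 * m (\<delta> *\<^sub>R x)" for x
    by (simp add: u_def m_def quad_bump_def \<kappa>_def dot_square_norm power2_eq_square algebra_simps)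
  have Lu: "frac_lap s u x = \<delta> powr (2 * s) * (norm (\<delta> *\<^sub>R x))\<^sup>2 * n (\<delta> *\<^sub>R x)" for x
  proof -
    have "2 powr (2 * s) * (\<delta> / 2) powr (2 * s) = \<delta> powr (2 * s)"
      using \<delta> by (simp add: powr_divide)
    then have "frac_lap s u x = \<delta> powr (2 * s) * (frac_lap s ?v (\<delta> *\<^sub>R x) - frac_lap s ?v ((\<delta> / 2) *\<^sub>R x))"
      unfolding u_def[abs_def] using \<delta>
      by (subst frac_lap_lincomb[OF s tv tv]) (simp_all add: algebra_simps)
    also have "frac_lap s ?v (\<delta> *\<^sub>R x) - frac_lap s ?v ((\<delta> / 2) *\<^sub>R x) = (norm (\<delta> *\<^sub>R x))\<^sup>2 * n (\<delta> *\<^sub>R x)"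
      unfolding Q(4)[of "\<delta> *\<^sub>R x"] Q(4)[of "(\<delta> / 2) *\<^sub>R x"]
      by (simp add: n_def algebra_simps power2_eq_square)
    finally show ?thesis by (simp add: mult.assoc)
  qed
  have small: "norm (\<delta> *\<^sub>R x) < \<delta>" if "x \<in> ball 0 1" for x :: 'a
    using that \<delta> by simp
  have mpos: "m (\<delta> *\<^sub>R x) > 0" and npos: "n (\<delta> *\<^sub>R x) > 0" if "x \<in> ball 0 1" for x
    using \<delta>(3)[OF small[OF that]] by auto
  have C1V: "C1_on (ball 0 1) V"
    unfolding V_def[abs_def]
    by (intro C1_on_divide C1_on_subset[OF Cn] C1_on_subset[OF Cm]) (use mpos in \<open>auto simp: less_le\<close>)
  have weak: "Ds_inner s u \<phi> = (\<integral>x. V x * u x * \<phi> x \<partial>lborel)" if \<phi>: "test_fun (ball 0 1) \<phi>" for \<phi>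
  proof -
    have "Ds_inner s u \<phi> = c * (\<integral>x. frac_lap s u x * \<phi> x \<partial>lborel)"
      unfolding Ds_inner_def c_def gagliardo_form_eq[OF s tu \<phi>] ..
    also have "\<dots> = (\<integral>x. c * (frac_lap s u x * \<phi> x) \<partial>lborel)" by simp
    also have "\<dots> = (\<integral>x. V x * u x * \<phi> x \<partial>lborel)"
    proof (rule Bochner_Integration.integral_cong)
      fix x
      \<comment> \<open>Inside the unit ball the common factor \<open>m\<close> cancels, the origin
        included, where both sides are 0. Outside it \<open>\<phi>\<close> vanishes, so the values
        of \<open>V\<close> beyond the zeros of \<open>m\<close> are irrelevant.\<close>
      show "c * (frac_lap s u x * \<phi> x) = V x * u x * \<phi> x"
      proof (cases "x \<in> ball 0 1")
        case True
        then show ?thesis using mpos[OF True] by (simp add: Lu u_m V_def)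
      next
        case False
        then have "x \<notin> tsupp \<phi>" using \<phi> by (auto simp: test_fun_def)
        then have "\<phi> x = 0" unfolding tsupp_def using closure_subset[of "{x. \<phi> x \<noteq> 0}"] by auto
        then show ?thesis by simp
      qed
    qed simp
    finally show ?thesis .
  qed
  \<comment> \<open>The wider dilate \<open>?v ((\<delta> / 2) *\<^sub>R x)\<close> is supported in
    \<open>|x| \<le> 2 / \<delta>\<close>.\<close>
  define R where "R = 2 / \<delta>"
  have R: "R \<ge> 1" using \<delta> by (simp add: R_def)
  have zero: "u x = 0" if "norm x \<ge> R" for x
  proof -
    have "norm (\<delta> *\<^sub>R x) \<ge> 2" using that \<delta> by (simp add: R_def field_simps)
    then show ?thesis using \<delta> by (simp add: u_m m_def bump_zero)
  qed
  have cu: "continuous_on UNIV u" by (rule test_fun_continuous[OF tu])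
  have dense: "\<exists>x\<in>\<Omega>. u x \<noteq> 0" if \<Omega>: "open \<Omega>" "\<Omega> \<noteq> {}" "\<Omega> \<subseteq> ball 0 R" for \<Omega>
  proof (rule ccontr)
    assume "\<not> ?thesis"
    then have u0: "u x = 0" if "x \<in> \<Omega>" for x using that by blast
    \<comment> \<open>An open set contains, together with a nonzero point \<open>x\<close>, a
      slightly stretched \<open>r *\<^sub>R x\<close>. If \<open>u\<close> vanished at both, there
      would be zeros on two different spheres.\<close>
    have "\<Omega> \<noteq> {0}" using \<Omega>(1) not_open_singleton[of "0::'a"] by auto
    then obtain x where x: "x \<in> \<Omega>" "x \<noteq> 0" using \<Omega>(2) by blast
    obtain e where e: "e > 0" "ball x e \<subseteq> \<Omega>" using \<Omega>(1) x(1) open_contains_ball by blast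
    define r where "r = 1 + e / (2 * norm x)"
    have r: "r > 1" using e x by (simp add: r_def)
    have "dist x (r *\<^sub>R x) = norm ((e / (2 * norm x)) *\<^sub>R x)"
      by (simp add: dist_norm r_def algebra_simps)
    also have "\<dots> < e" using e x by simp
    finally have rx: "r *\<^sub>R x \<in> \<Omega>" using e(2) by auto
    define t where "t y = (norm (\<delta> *\<^sub>R y))\<^sup>2" for y :: 'a
    have t: "0 \<le> t y" "t y < 4" "flat 100 0 (1 - t y) = \<kappa> * flat 100 0 (1 - t y / 4)"
      if y: "y \<in> \<Omega>" "y \<noteq> 0" for y
    proof -
      have "norm y < R" using y(1) \<Omega>(3) by (auto simp: subset_iff)
      then have "norm (\<delta> *\<^sub>R y) < 2" using \<delta>(1) by (simp add: R_def field_simps)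
      then show "t y < 4" using power_strict_mono[of "norm (\<delta> *\<^sub>R y)" 2 2] by (simp add: t_def)
      have "m (\<delta> *\<^sub>R y) = 0" using u0[OF y(1)] y(2) \<delta> by (simp add: u_m)
      then show "flat 100 0 (1 - t y) = \<kappa> * flat 100 0 (1 - t y / 4)"
        by (simp add: m_def bump_def t_def dot_square_norm power_divide power_mult_distrib)
    qed (simp add: t_def)
    have rx0: "r *\<^sub>R x \<noteq> 0" using r x(2) by simp
    have "t x = t (r *\<^sub>R x)"
      by (rule bump_difference_zero_unique[OF \<kappa>(1) t(1,2)[OF x] t(1,2)[OF rx rx0] t(3)[OF x] t(3)[OF rx rx0]])
    then have "r\<^sup>2 = 1" using \<delta> x by (simp add: t_def power_mult_distrib)
    then show False using r by (simp add: power2_eq_1_iff)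
  qed
  have notAE: "\<not> (AE x in lborel. x \<in> \<Omega> \<longrightarrow> u x = 0)" if \<Omega>: "open \<Omega>" "\<Omega> \<noteq> {}" "\<Omega> \<subseteq> ball 0 R" for \<Omega>
  proof
    assume "AE x in lborel. x \<in> \<Omega> \<longrightarrow> u x = 0"
    then have "AE x in lborel. x \<notin> \<Omega> \<inter> {x. u x \<noteq> 0}" by (rule eventually_mono) auto
    moreover have "open {x. u x \<noteq> 0}" using cu by (intro open_Collect_neq) auto
    ultimately show False
      using open_not_AE_notin[of "\<Omega> \<inter> {x. u x \<noteq> 0}"] dense[OF \<Omega>] \<Omega>(1) by auto
  qed
  have "thm12_props s V u"
    unfolding thm12_props_def radial_weak_solution_def Ds2_rad_def
  proof (intro conjI ballI allI impI CollectI exI[of _ R])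
    show "radial V" unfolding radial_def
    proof (intro allI impI)
      fix x y :: 'a assume "norm x = norm y"
      then have "norm (\<delta> *\<^sub>R x) = norm (\<delta> *\<^sub>R y)" by simp
      then show "V x = V y" unfolding V_def using rn rm by metis
    qed
    show "radial u" unfolding radial_def
    proof (intro allI impI)
      fix x y :: 'a assume "norm x = norm y"
      then have "norm (\<delta> *\<^sub>R x) = norm (\<delta> *\<^sub>R y)" by simp
      then show "u x = u y" unfolding u_m using rm by metis
    qed
    show "continuous_on (ball 0 1) V" by (rule C1_on_imp_continuous_on[OF C1V])
    show "C1_on (ball 0 1 - {0}) V" by (rule C1_on_subset[OF C1V]) auto
    show "\<exists>g::'a \<Rightarrow> 'a. (\<forall>x\<in>ball 0 1 - {0}. (V has_derivative (\<lambda>h. g x \<bullet> h)) (at x)) \<and>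
        (\<exists>CV>0. \<exists>\<epsilon>>0. eventually (\<lambda>x. \<bar>V x\<bar> + \<bar>x \<bullet> g x\<bar> \<le> CV * norm x powr (- 2 * s + \<epsilon>)) (at 0))"
      by (rule C1_on_ball_growth_bound[OF C1V s(1)])
    show "0 < V x" if "x \<in> ball 0 1 - {0}" for x
      using that mpos[of x] npos[of x] c \<delta> by (simp add: V_def)
    show "u \<in> Ds2 s" by (rule test_fun_in_Ds2[OF tu])
    show "\<not> (AE x in lborel. u x = 0)"
    proof
      assume "AE x in lborel. u x = 0"
      then have "AE x in lborel. x \<in> ball 0 R \<longrightarrow> u x = 0" by (rule eventually_mono) simp
      then show False using notAE[of "ball 0 R"] R by simp
    qed
    show "isCont u 0" using cu by (simp add: continuous_on_eq_continuous_at)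
    show "u 0 = 0" by (simp add: u_m)
  qed (use weak R zero notAE in auto)
  with C1V show ?thesis by blast
qed

theorem theorem1p2:
  fixes s :: real
  assumes "0 < s" and "s < min (real DIM('a::euclidean_space) / 2) 1"
  shows "(\<exists>(V::'a \<Rightarrow> real) u. thm12_props s V u) \<and>
         (real DIM('a) \<ge> 6 * s \<longrightarrow>
            (\<forall>\<alpha>. 0 < \<alpha> \<and> \<alpha> < 4 * s / (real DIM('a) - 2 * s) \<longrightarrow>
               (\<exists>(V::'a \<Rightarrow> real) u. thm12_props s V u \<and> holder_loc \<alpha> (ball 0 1) V))) \<and>
         (real DIM('a) < 6 * s \<longrightarrow>
            (\<exists>(V::'a \<Rightarrow> real) u. thm12_props s V u \<and> C1_on (ball 0 1) V))"
proof -
  obtain V :: "'a \<Rightarrow> real" and u where *: "thm12_props s V u" "C1_on (ball 0 1) V"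
    using exists_potential_and_solution[of s] assms by auto
  have "holder_loc \<alpha> (ball 0 1) V"
    if N: "real DIM('a) \<ge> 6 * s" and \<alpha>: "0 < \<alpha>" "\<alpha> < 4 * s / (real DIM('a) - 2 * s)" for \<alpha>
  proof (rule C1_on_ball_imp_holder_loc[OF *(2) \<alpha>(1)])
    \<comment> \<open>The condition \<open>N \<ge> 6 s\<close> says exactly that
      \<open>N - 2 s \<ge> 4 s\<close>, so every admissible exponent is below 1.\<close>
    have "4 * s / (real DIM('a) - 2 * s) \<le> 1" using N assms(1) by (simp add: divide_le_eq)
    then show "\<alpha> \<le> 1" using \<alpha>(2) by simp
  qed
  with * show ?thesis by blast
qed

end
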